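(* Let $\{SC_i\}_{1\le i\le p}$ be an independent family of $n\times n$ symmetric circulant random matrices satisfying Assumption I of the context. Then, as $n\to\infty$, $\{n^{-1/2}SC_i\}_{1\le i\le p}$, viewed as elements of the noncommutative probability space of $n\times n$ random matrices with functional $\phi_n=\frac1n\mathbb{E}[\mathrm{Tr}(\cdot)]$, converges in law to $\{a_i\}_{1\le i\le p}$ which are (classically) independent and each of which is distributed according to the standard Gaussian law; that is, for all $k\ge 1$ and all $i_1,\dots,i_k\in\{1,\dots,p\}$, $$\lim_{n\to\infty}\frac{1}{n^{1+k/2}}\mathbb{E}[\mathrm{Tr}(SC_{i_1}\cdots SC_{i_k})]=\mathbb{E}[a_{i_1}\cdots a_{i_k}],$$ where $a_1,\dots,a_p$ are i.i.d. real standard normal random variables.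
   Context: **Convergence in law.** A noncommutative probability space is a pair $(\mathcal{A},\phi)$ with $\mathcal{A}$ a unital complex algebra and $\phi:\mathcal{A}\to\mathbb{C}$ linear with $\phi(1)=1$. A family $\{a_i^n\}_{1\le i\le p}\subset(\mathcal{A}_n,\phi_n)$ converges in law to $\{a_i\}_{1\le i\le p}\subset(\mathcal{A},\phi)$ if $\phi_n(P(a_1^n,\dots,a_p^n))\to\phi(P(a_1,\dots,a_p))$ for every complex polynomial $P$ in $p$ noncommuting variables (equivalently, for every monomial). $\mathrm{Tr}$ is the unnormalized trace. **Symmetric circulant matrices and Assumption I.** The $n\times n$ symmetric circulant matrix $SC_i=SC_{i,n}$ has $(j,k)$ entry $X_{i,n}(L(j,k))$, $1\le j,k\le n$, with link function $L(j,k)=\frac n2-\big|\frac n2-|j-k|\big|$, where $X_{i,n}(t)$, $0\le t\le n/2$, is its input sequence of real random variables. Assumption I: for each $n$, the input variables of each matrix are independent with mean $0$ and variance $1$, they are also independent across $i\in\{1,\dots,p\}$, and for every integer $k\ge1$ there is $c_k<\infty$ with $\sup_n\sup_{1\le i\le p}\sup_{1\le m\le l\le n}\mathbb{E}[|X_{i,n}(L(m,l))|^k]\le c_k$. *)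

theory Defs
  imports
    "HOL-Probability.Probability"
    "HOL-Algebra.Module"
    "Jordan_Normal_Form.Matrix"
    "Jordan_Normal_Form.VS_Connect"
begin

section \<open>Noncommutative probability spaces\<close>

record 'a nc_space = "(complex, 'a) module" +
  state :: "'a \<Rightarrow> complex"

text \<open>The locale \<open>algebra\<close> of HOL-Algebra requires commutative multiplication, so unital
  complex algebras are axiomatised here on top of rings and modules.\<close>

locale nc_prob_space = ring A + module class_ring A
  for A :: "('a, 'm) nc_space_scheme" (structure) +
  assumes smult_mult_left:
      "x \<in> carrier A \<Longrightarrow> y \<in> carrier A \<Longrightarrow> (c \<odot> x) \<otimes> y = c \<odot> (x \<otimes> y)"
    and smult_mult_right:
      "x \<in> carrier A \<Longrightarrow> y \<in> carrier A \<Longrightarrow> x \<otimes> (c \<odot> y) = c \<odot> (x \<otimes> y)"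
    and state_add:
      "x \<in> carrier A \<Longrightarrow> y \<in> carrier A \<Longrightarrow> state A (x \<oplus> y) = state A x + state A y"
    and state_smult: "x \<in> carrier A \<Longrightarrow> state A (c \<odot> x) = c * state A x"
    and state_one: "state A \<one> = 1"

text \<open>A monomial in the noncommuting variables \<open>x\<^sub>1, \<dots>, x\<^sub>p\<close> is a word over \<open>{1..p}\<close>; a
  polynomial is given by its finitely supported family of coefficients.\<close>

definition nc_polys :: "nat \<Rightarrow> (nat list \<Rightarrow> complex) set" where
  "nc_polys p = {P. finite {w. P w \<noteq> 0} \<and> (\<forall>w. P w \<noteq> 0 \<longrightarrow> set w \<subseteq> {1..p})}"

definition nc_monom_eval :: "('a, 'm) nc_space_scheme \<Rightarrow> (nat \<Rightarrow> 'a) \<Rightarrow> nat list \<Rightarrow> 'a" where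
  "nc_monom_eval A a w = foldr (\<lambda>i x. a i \<otimes>\<^bsub>A\<^esub> x) w \<one>\<^bsub>A\<^esub>"

definition nc_poly_eval ::
    "('a, 'm) nc_space_scheme \<Rightarrow> (nat \<Rightarrow> 'a) \<Rightarrow> (nat list \<Rightarrow> complex) \<Rightarrow> 'a" where
  "nc_poly_eval A a P = (\<Oplus>\<^bsub>A\<^esub>w\<in>{w. P w \<noteq> 0}. P w \<odot>\<^bsub>A\<^esub> nc_monom_eval A a w)"

text \<open>Only the indices \<open>n \<ge> 1\<close> are considered: the normalised trace of a 0-by-0 matrix does
  not define a noncommutative probability space.\<close>

definition converges_in_law ::
    "nat \<Rightarrow> (nat \<Rightarrow> ('a, 'm) nc_space_scheme) \<Rightarrow> (nat \<Rightarrow> nat \<Rightarrow> 'a) \<Rightarrow>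
      ('b, 'k) nc_space_scheme \<Rightarrow> (nat \<Rightarrow> 'b) \<Rightarrow> bool" where
  "converges_in_law p A a B b \<longleftrightarrow>
     (\<forall>n\<ge>1. nc_prob_space (A n) \<and> (\<forall>i\<in>{1..p}. a n i \<in> carrier (A n))) \<and>
     nc_prob_space B \<and> (\<forall>i\<in>{1..p}. b i \<in> carrier B) \<and>
     (\<forall>P\<in>nc_polys p.
        (\<lambda>n. state (A n) (nc_poly_eval (A n) (a n) P)) \<longlonglongrightarrow> state B (nc_poly_eval B b P))"


section \<open>Random variables and random matrices with finite moments\<close>

definition finite_moments :: "'w measure \<Rightarrow> ('w \<Rightarrow> complex) set" where
  "finite_moments M = {f \<in> borel_measurable M. \<forall>k::nat. integrable M (\<lambda>w. cmod (f w) ^ k)}"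

definition random_variable_space :: "'w measure \<Rightarrow> ('w \<Rightarrow> complex) nc_space" where
  "random_variable_space M =
     \<lparr>carrier = finite_moments M,
      mult = (\<lambda>f g w. f w * g w), one = (\<lambda>w. 1),
      zero = (\<lambda>w. 0), add = (\<lambda>f g w. f w + g w),
      smult = (\<lambda>c f w. c * f w),
      state = (\<lambda>f. LINT w|M. f w)\<rparr>"

definition mat_trace :: "'a::comm_monoid_add mat \<Rightarrow> 'a" where
  "mat_trace A = (\<Sum>i<dim_row A. A $$ (i, i))"

definition random_matrix_space :: "'w measure \<Rightarrow> nat \<Rightarrow> ('w \<Rightarrow> complex mat) nc_space" where
  "random_matrix_space M n =
     \<lparr>carrier = {A. (\<forall>w. A w \<in> carrier_mat n n) \<and>
                    (\<forall>i<n. \<forall>j<n. (\<lambda>w. A w $$ (i, j)) \<in> finite_moments M)},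
      mult = (\<lambda>A B w. A w * B w), one = (\<lambda>w. 1\<^sub>m n),
      zero = (\<lambda>w. 0\<^sub>m n n), add = (\<lambda>A B w. A w + B w),
      smult = (\<lambda>c A w. c \<cdot>\<^sub>m A w),
      state = (\<lambda>A. 1 / of_nat n * (LINT w|M. mat_trace (A w)))\<rparr>"

lemma finite_moments_const: "prob_space M \<Longrightarrow> (\<lambda>_. c) \<in> finite_moments M"
  by (simp add: finite_moments_def prob_space.finite_measure finite_measure.integrable_const)

lemma finite_moments_integrable:
  assumes "f \<in> finite_moments M"
  shows "integrable M f"
proof -
  from assms have "integrable M (\<lambda>w. cmod (f w) ^ 1)" and [measurable]: "f \<in> borel_measurable M"
    by (auto simp only: finite_moments_def)
  then show ?thesis by (simp add: integrable_norm_iff)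
qed

lemma finite_moments_mult:
  assumes f: "f \<in> finite_moments M" and g: "g \<in> finite_moments M"
  shows "(\<lambda>w. f w * g w) \<in> finite_moments M"
proof -
  have [measurable]: "f \<in> borel_measurable M" "g \<in> borel_measurable M"
    using f g by (auto simp: finite_moments_def)
  have "integrable M (\<lambda>w. cmod (f w * g w) ^ k)" for k :: nat
  proof (rule Bochner_Integration.integrable_bound)
    show "integrable M (\<lambda>w. cmod (f w) ^ (2 * k) + cmod (g w) ^ (2 * k))"
      using f g by (simp add: finite_moments_def)
    have "x * y \<le> x\<^sup>2 + y\<^sup>2" if "x \<ge> 0" "y \<ge> 0" for x y :: real
      using sum_squares_bound[of x y] that mult_nonneg_nonneg[of x y] by linarith
    from this[of "cmod (f w) ^ k" "cmod (g w) ^ k" for w]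
    show "AE w in M. norm (cmod (f w * g w) ^ k)
        \<le> norm (cmod (f w) ^ (2 * k) + cmod (g w) ^ (2 * k))"
      by (simp add: norm_mult power_mult_distrib power_even_eq)
  qed measurable
  then show ?thesis by (simp add: finite_moments_def)
qed

lemma finite_moments_add:
  assumes f: "f \<in> finite_moments M" and g: "g \<in> finite_moments M"
  shows "(\<lambda>w. f w + g w) \<in> finite_moments M"
proof -
  have [measurable]: "f \<in> borel_measurable M" "g \<in> borel_measurable M"
    using f g by (auto simp: finite_moments_def)
  have "integrable M (\<lambda>w. cmod (f w + g w) ^ k)" for k :: nat
  proof (rule Bochner_Integration.integrable_bound)
    show "integrable M (\<lambda>w. 2 ^ k * (cmod (f w) ^ k + cmod (g w) ^ k))"
      using f g by (simp add: finite_moments_def)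
    have *: "cmod (x + y) ^ k \<le> 2 ^ k * (cmod x ^ k + cmod y ^ k)" for x y
    proof -
      have "cmod (x + y) ^ k \<le> (2 * max (cmod x) (cmod y)) ^ k"
        using norm_triangle_ineq[of x y] by (intro power_mono) auto
      also have "\<dots> = 2 ^ k * max (cmod x) (cmod y) ^ k"
        by (simp add: power_mult_distrib)
      also have "\<dots> \<le> 2 ^ k * (cmod x ^ k + cmod y ^ k)"
        by (auto simp: max_def)
      finally show ?thesis .
    qed
    show "AE w in M. norm (cmod (f w + g w) ^ k)
        \<le> norm (2 ^ k * (cmod (f w) ^ k + cmod (g w) ^ k))"
      using * by (simp add: abs_of_nonneg)
  qed measurable
  then show ?thesis by (simp add: finite_moments_def)
qed

lemma finite_moments_cmult:
  assumes "prob_space M" "f \<in> finite_moments M"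
  shows "(\<lambda>w. c * f w) \<in> finite_moments M"
  using finite_moments_mult[OF finite_moments_const[OF assms(1)] assms(2)] .

lemma finite_moments_sum:
  assumes "prob_space M" "\<And>i. i \<in> I \<Longrightarrow> f i \<in> finite_moments M"
  shows "(\<lambda>w. \<Sum>i\<in>I. f i w) \<in> finite_moments M"
  using assms(2)
proof (induction I rule: infinite_finite_induct)
  case (insert i I)
  then show ?case
    using finite_moments_add[of "f i" M "\<lambda>w. \<Sum>i\<in>I. f i w"] by simp
qed (auto simp: finite_moments_const assms(1))

lemma nc_prob_space_random_variable_space:
  assumes M: "prob_space M"
  shows "nc_prob_space (random_variable_space M)"
proof -
  interpret prob_space M by fact
  show ?thesis
    unfolding random_variable_space_def
    apply (unfold_locales)
    apply (auto simp: finite_moments_const finite_moments_mult finite_moments_add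
        finite_moments_cmult M algebra_simps Units_def finite_moments_integrable prob_space)
    subgoal for x
      using finite_moments_cmult[OF M, of x "-1"]
      by (intro bexI[of _ "\<lambda>w. - x w"]) (auto simp: fun_eq_iff)
    done
qed

lemma nc_prob_space_random_matrix_space:
  assumes M: "prob_space M" and n: "n \<ge> 1"
  shows "nc_prob_space (random_matrix_space M n)"
proof -
  interpret prob_space M by fact
  let ?C = "{A. (\<forall>w. A w \<in> carrier_mat n n) \<and>
                (\<forall>i<n. \<forall>j<n. (\<lambda>w. A w $$ (i, j)) \<in> finite_moments M)}"
  have dims: "A w \<in> carrier_mat n n" if "A \<in> ?C" for A w
    using that by simp
  have entry: "(\<lambda>w. A w $$ (i, j)) \<in> finite_moments M" if "A \<in> ?C" "i < n" "j < n" for A i j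
    using that by blast
  have CI: "A \<in> ?C" if "\<And>w. A w \<in> carrier_mat n n"
    "\<And>i j. i < n \<Longrightarrow> j < n \<Longrightarrow> (\<lambda>w. A w $$ (i, j)) \<in> finite_moments M" for A
    using that by blast
  have mult: "(\<lambda>w. A w * B w) \<in> ?C" if A: "A \<in> ?C" and B: "B \<in> ?C" for A B
  proof -
    have eq: "(A w * B w) $$ (i, j) = (\<Sum>k<n. A w $$ (i, k) * B w $$ (k, j))"
      if "i < n" "j < n" for i j w
    proof -
      have "dim_row (A w) = n" "dim_col (A w) = n" "dim_row (B w) = n" "dim_col (B w) = n"
        using dims[OF A, of w] dims[OF B, of w] by blast+
      then show ?thesis
        using that by (simp add: scalar_prod_def atLeast0LessThan)
    qed
    have "(\<lambda>w. (A w * B w) $$ (i, j)) \<in> finite_moments M" if "i < n" "j < n" for i j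
      unfolding eq[OF that]
    proof (rule finite_moments_sum[OF M])
      fix k assume "k \<in> {..<n}"
      then show "(\<lambda>w. A w $$ (i, k) * B w $$ (k, j)) \<in> finite_moments M"
        using entry[OF A that(1)] entry[OF B _ that(2)] by (intro finite_moments_mult) simp_all
    qed
    moreover have "A w * B w \<in> carrier_mat n n" for w
      using mult_carrier_mat[OF dims[OF A] dims[OF B]] .
    ultimately show ?thesis by blast
  qed
  have dim: "dim_row (A w) = n" "dim_col (A w) = n" if "A \<in> ?C" for A w
    using dims[OF that, of w] by blast+
  have entries: "(A w + B w) $$ (i, j) = A w $$ (i, j) + B w $$ (i, j)"
    "(c \<cdot>\<^sub>m A w) $$ (i, j) = c * A w $$ (i, j)"
    if "A \<in> ?C" "B \<in> ?C" "i < n" "j < n" for A B c i j w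
    using dim[OF that(1)] dim[OF that(2)] that(3,4) by simp_all
  have add: "(\<lambda>w. A w + B w) \<in> ?C" if "A \<in> ?C" "B \<in> ?C" for A B
  proof (rule CI)
    show "A w + B w \<in> carrier_mat n n" for w
      using add_carrier_mat[OF dims[OF that(2)]] .
    show "(\<lambda>w. (A w + B w) $$ (i, j)) \<in> finite_moments M" if "i < n" "j < n" for i j
      unfolding entries(1)[OF \<open>A \<in> ?C\<close> \<open>B \<in> ?C\<close> that]
      by (intro finite_moments_add entry that \<open>A \<in> ?C\<close> \<open>B \<in> ?C\<close>)
  qed
  have smult: "(\<lambda>w. c \<cdot>\<^sub>m A w) \<in> ?C" if "A \<in> ?C" for A c
  proof (rule CI)
    show "c \<cdot>\<^sub>m A w \<in> carrier_mat n n" for w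
      using smult_carrier_mat[OF dims[OF that]] .
    show "(\<lambda>w. (c \<cdot>\<^sub>m A w) $$ (i, j)) \<in> finite_moments M" if "i < n" "j < n" for i j
      unfolding entries(2)[OF \<open>A \<in> ?C\<close> \<open>A \<in> ?C\<close> that]
      by (rule finite_moments_cmult[OF M entry[OF \<open>A \<in> ?C\<close> that]])
  qed
  have const: "(\<lambda>w. B) \<in> ?C" if "B \<in> carrier_mat n n" for B
    by (rule CI) (use that finite_moments_const[OF M] in blast)+
  have tr: "mat_trace (A w) = (\<Sum>i<n. A w $$ (i, i))" if "A \<in> ?C" for A w
    unfolding mat_trace_def dim(1)[OF that] ..
  have trace_int: "integrable M (\<lambda>w. mat_trace (A w))" if "A \<in> ?C" for A
    unfolding tr[OF that]
  proof (rule Bochner_Integration.integrable_sum)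
    fix i assume "i \<in> {..<n}"
    then show "integrable M (\<lambda>w. A w $$ (i, i))"
      by (intro finite_moments_integrable entry that) simp_all
  qed
  have trace_add: "mat_trace (A w + B w) = mat_trace (A w) + mat_trace (B w)"
    if "A \<in> ?C" "B \<in> ?C" for A B w
    using entries(1)[OF that] by (simp add: tr[OF add[OF that]] tr[OF that(1)] tr[OF that(2)] sum.distrib)
  have trace_smult: "mat_trace (c \<cdot>\<^sub>m A w) = c * mat_trace (A w)" if "A \<in> ?C" for A c w
    using entries(2)[OF that that] by (simp add: tr[OF smult[OF that]] tr[OF that] sum_distrib_left)
  have trace_one: "mat_trace (1\<^sub>m n :: complex mat) = of_nat n"
    by (simp add: mat_trace_def)
  let ?R = "random_matrix_space M n"
  have carrier: "carrier ?R = ?C"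
    and ops: "\<And>A B. A \<otimes>\<^bsub>?R\<^esub> B = (\<lambda>w. A w * B w)" "\<one>\<^bsub>?R\<^esub> = (\<lambda>w. 1\<^sub>m n)"
      "\<zero>\<^bsub>?R\<^esub> = (\<lambda>w. 0\<^sub>m n n)" "\<And>A B. A \<oplus>\<^bsub>?R\<^esub> B = (\<lambda>w. A w + B w)"
      "\<And>c A. c \<odot>\<^bsub>?R\<^esub> A = (\<lambda>w. c \<cdot>\<^sub>m A w)"
      "\<And>A. state ?R A = 1 / of_nat n * (LINT w|M. mat_trace (A w))"
    by (simp_all add: random_matrix_space_def)
  have group: "abelian_group ?R"
  proof (rule abelian_groupI, unfold carrier ops)
    fix A assume A: "A \<in> ?C"
    have "(- 1) \<cdot>\<^sub>m A w + A w = 0\<^sub>m n n" for w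
      by (rule eq_matI) (simp_all add: dim[OF A])
    then show "\<exists>B\<in>?C. (\<lambda>w. B w + A w) = (\<lambda>w. 0\<^sub>m n n)"
      by (intro bexI[OF _ smult[OF A, of "- 1"]] ext)
    show "(\<lambda>w. 0\<^sub>m n n + A w) = A"
      by (intro ext left_add_zero_mat[OF dims[OF A]])
    fix B assume B: "B \<in> ?C"
    show "(\<lambda>w. A w + B w) \<in> ?C" by (rule add[OF A B])
    show "(\<lambda>w. A w + B w) = (\<lambda>w. B w + A w)"
      by (intro ext comm_add_mat[OF dims[OF A] dims[OF B]])
    fix C assume C: "C \<in> ?C"
    show "(\<lambda>w. A w + B w + C w) = (\<lambda>w. A w + (B w + C w))"
      by (intro ext assoc_add_mat[OF dims[OF A] dims[OF B] dims[OF C]])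
  next
    show "(\<lambda>w. 0\<^sub>m n n) \<in> ?C" by (rule const[OF zero_carrier_mat])
  qed
  have monoid: "Group.monoid ?R"
  proof (rule monoidI, unfold carrier ops)
    fix A assume A: "A \<in> ?C"
    show "(\<lambda>w. 1\<^sub>m n * A w) = A" by (intro ext left_mult_one_mat[OF dims[OF A]])
    show "(\<lambda>w. A w * 1\<^sub>m n) = A" by (intro ext right_mult_one_mat[OF dims[OF A]])
    fix B assume B: "B \<in> ?C"
    show "(\<lambda>w. A w * B w) \<in> ?C" by (rule mult[OF A B])
    fix C assume C: "C \<in> ?C"
    show "(\<lambda>w. A w * B w * C w) = (\<lambda>w. A w * (B w * C w))"
      by (intro ext assoc_mult_mat[OF dims[OF A] dims[OF B] dims[OF C]])
  next
    show "(\<lambda>w. 1\<^sub>m n) \<in> ?C" by (rule const[OF one_carrier_mat])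
  qed
  have ring: "ring ?R"
  proof (rule ringI[OF group monoid], unfold carrier ops)
    fix A B C assume A: "A \<in> ?C" and B: "B \<in> ?C" and C: "C \<in> ?C"
    show "(\<lambda>w. (A w + B w) * C w) = (\<lambda>w. A w * C w + B w * C w)"
      by (intro ext add_mult_distrib_mat[OF dims[OF A] dims[OF B] dims[OF C]])
    show "(\<lambda>w. C w * (A w + B w)) = (\<lambda>w. C w * A w + C w * B w)"
      by (intro ext mult_add_distrib_mat[OF dims[OF C] dims[OF A] dims[OF B]])
  qed
  have module: "module class_ring ?R"
  proof (rule moduleI[OF class_cring.cring_axioms group], unfold carrier ops)
    fix c d :: complex and A assume A: "A \<in> ?C"
    show "(\<lambda>w. c \<cdot>\<^sub>m A w) \<in> ?C" by (rule smult[OF A])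
    show "(\<lambda>w. (c \<oplus>\<^bsub>class_ring\<^esub> d) \<cdot>\<^sub>m A w) = (\<lambda>w. c \<cdot>\<^sub>m A w + d \<cdot>\<^sub>m A w)"
      using add_smult_distrib_right_mat[OF dims[OF A]] by simp
    show "(\<lambda>w. (c \<otimes>\<^bsub>class_ring\<^esub> d) \<cdot>\<^sub>m A w) = (\<lambda>w. c \<cdot>\<^sub>m (d \<cdot>\<^sub>m A w))"
      by (intro ext eq_matI) (simp_all add: dim[OF A])
    show "(\<lambda>w. \<one>\<^bsub>class_ring\<^esub> \<cdot>\<^sub>m A w) = A"
      by (intro ext eq_matI) (simp_all add: dim[OF A])
    fix B assume B: "B \<in> ?C"
    show "(\<lambda>w. c \<cdot>\<^sub>m (A w + B w)) = (\<lambda>w. c \<cdot>\<^sub>m A w + c \<cdot>\<^sub>m B w)"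
      by (intro ext add_smult_distrib_left_mat[OF dims[OF A] dims[OF B]])
  qed
  show ?thesis
  proof (intro nc_prob_space.intro ring module nc_prob_space_axioms.intro, unfold carrier ops)
    fix A c assume A: "A \<in> ?C"
    show "1 / of_nat n * (LINT w|M. mat_trace (c \<cdot>\<^sub>m A w)) =
        c * (1 / of_nat n * (LINT w|M. mat_trace (A w)))"
      unfolding trace_smult[OF A] by simp
    fix B assume B: "B \<in> ?C"
    show "(\<lambda>w. c \<cdot>\<^sub>m A w * B w) = (\<lambda>w. c \<cdot>\<^sub>m (A w * B w))"
      by (intro ext mult_smult_assoc_mat[OF dims[OF A] dims[OF B]])
    show "(\<lambda>w. A w * (c \<cdot>\<^sub>m B w)) = (\<lambda>w. c \<cdot>\<^sub>m (A w * B w))"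
      by (intro ext mult_smult_distrib[OF dims[OF A] dims[OF B]])
    show "1 / of_nat n * (LINT w|M. mat_trace (A w + B w)) =
        1 / of_nat n * (LINT w|M. mat_trace (A w)) + 1 / of_nat n * (LINT w|M. mat_trace (B w))"
      unfolding trace_add[OF A B] Bochner_Integration.integral_add[OF trace_int[OF A] trace_int[OF B]]
      by (rule distrib_left)
  next
    show "1 / of_nat n * (LINT w|M. mat_trace (1\<^sub>m n :: complex mat)) = 1"
      using n by (simp add: trace_one prob_space)
  qed
qed


section \<open>Symmetric circulant matrices\<close>

definition link :: "nat \<Rightarrow> nat \<Rightarrow> nat \<Rightarrow> nat" where
  "link n j k = nat \<lfloor>real n / 2 - \<bar>real n / 2 - \<bar>real j - real k\<bar>\<bar>\<rfloor>"

text \<open>The rounding in the definition only changes the type.\<close>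

lemma real_link:
  assumes "j \<in> {1..n}" "k \<in> {1..n}"
  shows "real (link n j k) = real n / 2 - \<bar>real n / 2 - \<bar>real j - real k\<bar>\<bar>"
proof -
  define d where "d = \<bar>int j - int k\<bar>"
  have d: "\<bar>real j - real k\<bar> = of_int d" "0 \<le> d" "d \<le> int n"
    using assms by (auto simp: d_def)
  have "real n / 2 - \<bar>real n / 2 - of_int d\<bar> = of_int (min d (int n - d))"
    using d by (auto simp: min_def abs_if field_simps)
  then show ?thesis using d by (simp add: link_def)
qed

text \<open>Matrix indices start from 0 in the library, whence the successors.\<close>

definition sym_circulant :: "nat \<Rightarrow> (nat \<Rightarrow> 'a) \<Rightarrow> 'a mat" where
  "sym_circulant n x = mat n n (\<lambda>(j, k). x (link n (Suc j) (Suc k)))"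

text \<open>\<open>X i n t\<close> is the entry number \<open>t\<close>, for \<open>0 \<le> t \<le> n / 2\<close>, of the input sequence of the
  \<open>i\<close>-th matrix of size \<open>n\<close>, a random variable on \<open>M n\<close>.\<close>

definition assumption_I ::
    "nat \<Rightarrow> (nat \<Rightarrow> 'w measure) \<Rightarrow> (nat \<Rightarrow> nat \<Rightarrow> nat \<Rightarrow> 'w \<Rightarrow> real) \<Rightarrow> bool" where
  "assumption_I p M X \<longleftrightarrow>
     (\<forall>n\<ge>1. prob_space (M n) \<and>
        prob_space.indep_vars (M n) (\<lambda>_. borel) (\<lambda>(i, t). X i n t) ({1..p} \<times> {t. real t \<le> real n / 2}) \<and>
        (\<forall>i\<in>{1..p}. \<forall>t. real t \<le> real n / 2 \<longrightarrow>
           prob_space.expectation (M n) (X i n t) = 0 \<and>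
           prob_space.variance (M n) (X i n t) = 1)) \<and>
     (\<forall>k\<ge>1. \<exists>c::real. \<forall>n\<ge>1. \<forall>i\<in>{1..p}. \<forall>m l. 1 \<le> m \<and> m \<le> l \<and> l \<le> n \<longrightarrow>
        integrable (M n) (\<lambda>w. \<bar>X i n (link n m l) w\<bar> ^ k) \<and>
        prob_space.expectation (M n) (\<lambda>w. \<bar>X i n (link n m l) w\<bar> ^ k) \<le> c)"

definition sc_matrix ::
    "(nat \<Rightarrow> nat \<Rightarrow> nat \<Rightarrow> 'w \<Rightarrow> real) \<Rightarrow> nat \<Rightarrow> nat \<Rightarrow> 'w \<Rightarrow> real mat" where
  "sc_matrix X i n w = sym_circulant n (\<lambda>t. X i n t w)"

end

theory Submission
  imports Defs "HOL-Real_Asymp.Real_Asymp"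
begin

text \<open>Symmetric circulant matrices of size \<open>n\<close> are even convolution operators on the cyclic group, so
  they commute and have the waves \<open>cos (2 \<pi> m (j - l) / n)\<close> as common eigenvectors. The trace of a
  product is therefore the sum over the frequencies \<open>m < n\<close> of the products of the eigenvalues
  (\<open>trace_sc_product\<close>), and the limit reduces to classical probability.

  Each eigenvalue is a linear combination of the \<open>n div 2 + 1\<close> independent inputs
  (\<open>circ_eigenvalue_half\<close>). Divided by \<open>sqrt n\<close>, its coefficients are \<open>O(1 / sqrt n)\<close>, and their squares
  sum to \<open>1 + O(1 / n)\<close>, except for \<open>m = 0\<close> and \<open>m = n / 2\<close>, where they sum to \<open>2 + O(1 / n)\<close>
  (\<open>sum_sq_circ_weight\<close>). A central limit theorem for moments with an error bound
  (\<open>moment_central_limit\<close>) shows that the moments of the scaled eigenvalue are Gaussian up to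
  \<open>O(1 / sqrt n)\<close>, uniformly in \<open>m\<close>. It is proved by induction on the moment: expanding one factor
  of the power gives a recurrence which, up to higher moments of the small summands, is the recurrence
  of Gaussian moments.

  Eigenvalues of different matrices at the same frequency are independent, so the mixed moments
  factorise just as those of independent Gaussian variables (\<open>eigenvalue_word_limit\<close>). In the
  normalised trace, an average over \<open>m\<close>, the at most two exceptional frequencies have vanishing
  weight (\<open>average_limit\<close>), which gives the limit for words (\<open>trace_word_limit\<close>). Noncommutative
  polynomials follow by linearity of the states.\<close>

section \<open>A moment central limit theorem with an error bound\<close>

text \<open>Embedding a real random variable into the complex ones makes the closure properties of
  \<open>finite_moments\<close> available for it.\<close>

abbreviation has_moments :: "'w measure \<Rightarrow> ('w \<Rightarrow> real) \<Rightarrow> bool" where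
  "has_moments M f \<equiv> (\<lambda>w. complex_of_real (f w)) \<in> finite_moments M"

lemma has_moments_iff:
  "has_moments M f \<longleftrightarrow> f \<in> borel_measurable M \<and> (\<forall>k::nat. integrable M (\<lambda>w. \<bar>f w\<bar> ^ k))"
proof -
  have "(\<lambda>w. complex_of_real (f w)) \<in> borel_measurable M" if "f \<in> borel_measurable M"
    by (rule measurable_compose[OF that borel_measurable_of_real])
  moreover have "f \<in> borel_measurable M" if "(\<lambda>w. complex_of_real (f w)) \<in> borel_measurable M"
    using measurable_compose[OF that borel_measurable_Re] by (simp only: Re_complex_of_real)
  ultimately have "(\<lambda>w. complex_of_real (f w)) \<in> borel_measurable M \<longleftrightarrow> f \<in> borel_measurable M"
    by (rule iffI[rotated])
  then show ?thesis unfolding finite_moments_def mem_Collect_eq norm_of_real by (rule conj_cong[OF _ refl])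
qed

lemma has_moments_integrable: "has_moments M f \<Longrightarrow> integrable M f"
  using finite_moments_integrable[of "\<lambda>w. complex_of_real (f w)" M]
  by (simp add: complex_of_real_integrable_eq)

lemma has_moments_power: "prob_space M \<Longrightarrow> has_moments M f \<Longrightarrow> has_moments M (\<lambda>w. f w ^ k)"
proof (induction k)
  case (Suc k)
  then show ?case using finite_moments_mult[of "\<lambda>w. complex_of_real (f w)" M] by simp
qed (simp add: finite_moments_const)

lemma has_moments_mult: "has_moments M f \<Longrightarrow> has_moments M g \<Longrightarrow> has_moments M (\<lambda>w. f w * g w)"
  using finite_moments_mult[of "\<lambda>w. complex_of_real (f w)" M "\<lambda>w. complex_of_real (g w)"] by simp

lemma has_moments_sum:
  assumes "prob_space M" "\<And>t. t \<in> I \<Longrightarrow> has_moments M (f t)"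
  shows "has_moments M (\<lambda>w. \<Sum>t\<in>I. f t w)"
  using finite_moments_sum[OF assms(1), of I "\<lambda>t w. complex_of_real (f t w)"] assms(2) by simp

lemma has_moments_cmult: "prob_space M \<Longrightarrow> has_moments M f \<Longrightarrow> has_moments M (\<lambda>w. c * f w)"
  using finite_moments_cmult[of M "\<lambda>w. complex_of_real (f w)" "complex_of_real c"] by simp

text \<open>The recursion is Stein's integration by parts for the centred Gaussian law of variance \<open>s\<close>;
  for \<open>k = 0\<close> the truncated subtraction is harmless because of the factor \<open>k\<close>.\<close>

fun gauss_moment :: "real \<Rightarrow> nat \<Rightarrow> real" where
  "gauss_moment s 0 = 1"
| "gauss_moment s (Suc k) = real k * s * gauss_moment s (k - 1)"

text \<open>One factor of the power is written as \<open>\<Sum>t. Z t\<close>, and in the remaining \<open>k\<close> factors the sum is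
  split into \<open>Z t\<close> and the rest, which is independent of \<open>Z t\<close>.\<close>

lemma moment_sum_recurrence:
  fixes Z :: "'i \<Rightarrow> 'w \<Rightarrow> real"
  assumes M: "prob_space M" and I: "finite I"
    and indep: "prob_space.indep_vars M (\<lambda>_. borel) Z I"
    and mom: "\<And>t. t \<in> I \<Longrightarrow> has_moments M (Z t)"
  shows "(LINT w|M. (\<Sum>t\<in>I. Z t w) ^ Suc k) =
    (\<Sum>t\<in>I. \<Sum>j\<le>k. real (k choose j) * (LINT w|M. Z t w ^ Suc j) *
      (LINT w|M. (\<Sum>u\<in>I - {t}. Z u w) ^ (k - j)))"
proof -
  interpret prob_space M by fact
  define R where "R t w = (\<Sum>u\<in>I - {t}. Z u w)" for t w
  have R: "has_moments M (R t)" for t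
    unfolding R_def using mom by (intro has_moments_sum[OF M]) auto
  have expand: "(\<Sum>t\<in>I. Z t w) ^ Suc k =
      (\<Sum>t\<in>I. \<Sum>j\<le>k. real (k choose j) * (Z t w ^ Suc j * R t w ^ (k - j)))" for w
  proof -
    have "(\<Sum>t\<in>I. Z t w) ^ Suc k = (\<Sum>t\<in>I. Z t w * (\<Sum>u\<in>I. Z u w) ^ k)"
      by (simp add: sum_distrib_right)
    also have "\<dots> = (\<Sum>t\<in>I. Z t w * (Z t w + R t w) ^ k)"
      using I by (intro sum.cong) (auto simp: R_def sum.remove[where A = I])
    also have "\<dots> = (\<Sum>t\<in>I. \<Sum>j\<le>k. real (k choose j) * (Z t w ^ Suc j * R t w ^ (k - j)))"
      by (simp add: binomial_ring sum_distrib_left mult_ac)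
    finally show ?thesis .
  qed
  have split: "integrable M (\<lambda>w. Z t w ^ Suc j * R t w ^ (k - j))"
    "(LINT w|M. Z t w ^ Suc j * R t w ^ (k - j)) =
      (LINT w|M. Z t w ^ Suc j) * (LINT w|M. R t w ^ (k - j))" if "t \<in> I" for t j
  proof -
    have "indep_var borel (Z t) borel (R t)"
      unfolding R_def using I indep that insert_Diff[OF that]
      by (intro indep_vars_sum) auto
    then have "indep_var borel ((\<lambda>x. x ^ Suc j) \<circ> Z t) borel ((\<lambda>x. x ^ (k - j)) \<circ> R t)"
      by (rule indep_var_compose) auto
    then have ind: "indep_var borel (\<lambda>w. Z t w ^ Suc j) borel (\<lambda>w. R t w ^ (k - j))"
      by (simp add: comp_def)
    have int: "integrable M (\<lambda>w. Z t w ^ Suc j)" "integrable M (\<lambda>w. R t w ^ (k - j))"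
      by (rule has_moments_integrable has_moments_power M mom that R)+
    show "integrable M (\<lambda>w. Z t w ^ Suc j * R t w ^ (k - j))"
      by (rule indep_var_integrable[OF ind int])
    show "(LINT w|M. Z t w ^ Suc j * R t w ^ (k - j)) =
      (LINT w|M. Z t w ^ Suc j) * (LINT w|M. R t w ^ (k - j))"
      by (rule indep_var_lebesgue_integral[OF ind int])
  qed
  have "(LINT w|M. (\<Sum>t\<in>I. Z t w) ^ Suc k) =
      (\<Sum>t\<in>I. \<Sum>j\<le>k. LINT w|M. real (k choose j) * (Z t w ^ Suc j * R t w ^ (k - j)))"
    unfolding expand using split(1)
    by (subst Bochner_Integration.integral_sum, intro Bochner_Integration.integrable_sum
        integrable_mult_right, assumption, intro sum.cong refl Bochner_Integration.integral_sum
        integrable_mult_right, assumption)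
  also have "\<dots> = (\<Sum>t\<in>I. \<Sum>j\<le>k. real (k choose j) * (LINT w|M. Z t w ^ Suc j) *
      (LINT w|M. R t w ^ (k - j)))"
    by (intro sum.cong refl) (simp only: integral_mult_right_zero split(2) mult.assoc)
  finally show ?thesis
    unfolding R_def .
qed

lemma abs_sum_le: "(\<And>t. t \<in> I \<Longrightarrow> \<bar>f t\<bar> \<le> g t) \<Longrightarrow> \<bar>sum f I\<bar> \<le> sum g I"
  for f g :: "'i \<Rightarrow> real"
  by (rule order_trans[OF sum_abs sum_mono])

text \<open>Centred independent summands whose size is controlled by \<open>d\<close>: for \<open>Z t = b t * X t\<close> with
  \<open>\<bar>b t\<bar> \<le> d \<le> 1\<close> and normalised \<open>X t\<close>, the \<open>j + 3\<close>-th moment carries \<open>j + 1\<close> factors \<open>b t\<close>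
  beyond the variance, of which one is kept. This is the shape of Lyapunov's condition.\<close>

definition small_summands ::
    "(nat \<Rightarrow> real) \<Rightarrow> 'w measure \<Rightarrow> ('i \<Rightarrow> 'w \<Rightarrow> real) \<Rightarrow> real \<Rightarrow> 'i set \<Rightarrow> bool" where
  "small_summands c M Z d I \<longleftrightarrow>
     prob_space M \<and> 0 \<le> d \<and> d \<le> 1 \<and> finite I \<and> prob_space.indep_vars M (\<lambda>_. borel) Z I \<and>
     (\<forall>t\<in>I. has_moments M (Z t) \<and> (LINT w|M. Z t w) = 0 \<and> (LINT w|M. (Z t w)\<^sup>2) \<le> d \<and>
        (\<forall>j. \<bar>LINT w|M. Z t w ^ (j + 3)\<bar> \<le> c j * d * (LINT w|M. (Z t w)\<^sup>2)))"

lemma small_summands_mono: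
  assumes "small_summands c M Z d I" "J \<subseteq> I"
  shows "small_summands c M Z d J"
proof -
  have "prob_space.indep_vars M (\<lambda>_. borel) Z J"
    using assms unfolding small_summands_def by (blast intro: prob_space.indep_vars_subset)
  then show ?thesis
    using assms finite_subset unfolding small_summands_def by blast
qed

text \<open>Third and higher moments of the summands contribute \<open>O(d)\<close> to the recurrence, and dropping
  one summand changes the total variance by at most \<open>d\<close>; hence the moments of the sum satisfy
  the recursion of the Gaussian moments up to \<open>O(d)\<close>. The slack \<open>K\<close> in the total variance has to
  be universally quantified in the induction, since it grows when a summand is dropped.\<close>

lemma moment_central_limit:
  fixes c :: "nat \<Rightarrow> real"
  assumes s: "s \<ge> 0" and c: "\<And>j. c j \<ge> 0" and "K \<ge> 0"
  shows "\<exists>C\<ge>0. \<forall>(M :: 'w measure) (Z :: 'i \<Rightarrow> 'w \<Rightarrow> real) d I.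
    small_summands c M Z d I \<longrightarrow> \<bar>(\<Sum>t\<in>I. LINT w|M. (Z t w)\<^sup>2) - s\<bar> \<le> K * d \<longrightarrow>
    \<bar>(LINT w|M. (\<Sum>t\<in>I. Z t w) ^ k) - gauss_moment s k\<bar> \<le> C * d"
  using \<open>K \<ge> 0\<close>
proof (induction k arbitrary: K rule: less_induct)
  case (less k)
  show ?case
  proof (cases k)
    case 0
    then show ?thesis
      by (intro exI[of _ 0]) (auto simp: small_summands_def prob_space.prob_space)
  next
    case (Suc l)
    \<comment> \<open>Slack \<open>K + 1\<close>, as the induction hypothesis is applied after dropping one summand.\<close>
    have "\<forall>r. \<exists>C\<ge>0. r < k \<longrightarrow> (\<forall>(M :: 'w measure) (Z :: 'i \<Rightarrow> 'w \<Rightarrow> real) d I.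
      small_summands c M Z d I \<longrightarrow> \<bar>(\<Sum>t\<in>I. LINT w|M. (Z t w)\<^sup>2) - s\<bar> \<le> (K + 1) * d \<longrightarrow>
      \<bar>(LINT w|M. (\<Sum>t\<in>I. Z t w) ^ r) - gauss_moment s r\<bar> \<le> C * d)"
      using less.IH[of _ "K + 1"] less.prems by (metis add_nonneg_nonneg zero_le_one)
    then obtain C where C0: "\<And>r. C r \<ge> 0" and C: "\<And>r (M :: 'w measure) (Z :: 'i \<Rightarrow> 'w \<Rightarrow> real) d I.
      r < k \<Longrightarrow> small_summands c M Z d I \<Longrightarrow> \<bar>(\<Sum>t\<in>I. LINT w|M. (Z t w)\<^sup>2) - s\<bar> \<le> (K + 1) * d \<Longrightarrow>
      \<bar>(LINT w|M. (\<Sum>t\<in>I. Z t w) ^ r) - gauss_moment s r\<bar> \<le> C r * d"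
      by metis
    define B where "B r = \<bar>gauss_moment s r\<bar> + C r" for r
    define D where "D = (\<Sum>j\<in>{2..l}. real (l choose j) * c (j - 2) * B (l - j))"
    define E where "E = (s + K) * D + real l * (s + K) * C (l - 1) +
      real l * \<bar>gauss_moment s (l - 1)\<bar> * K"
    have B0: "B r \<ge> 0" for r using C0[of r] by (simp add: B_def)
    have D0: "D \<ge> 0" unfolding D_def using c B0 by (intro sum_nonneg) auto
    have E0: "E \<ge> 0" unfolding E_def using D0 C0 s less.prems by (intro add_nonneg_nonneg mult_nonneg_nonneg) auto
    have "\<bar>(LINT w|M. (\<Sum>t\<in>I. Z t w) ^ k) - gauss_moment s k\<bar> \<le> E * d"
      if S: "small_summands c M Z d I" and v: "\<bar>(\<Sum>t\<in>I. LINT w|M. (Z t w)\<^sup>2) - s\<bar> \<le> K * d"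
      for M :: "'w measure" and Z :: "'i \<Rightarrow> 'w \<Rightarrow> real" and d I
    proof -
      interpret prob_space M using S by (simp add: small_summands_def)
      have M: "prob_space M" and I: "finite I" and indep: "indep_vars (\<lambda>_. borel) Z I"
        and d: "0 \<le> d" "d \<le> 1"
        and mom: "\<And>t. t \<in> I \<Longrightarrow> has_moments M (Z t)"
        and mean: "\<And>t. t \<in> I \<Longrightarrow> (LINT w|M. Z t w) = 0"
        and var: "\<And>t. t \<in> I \<Longrightarrow> (LINT w|M. (Z t w)\<^sup>2) \<le> d"
        and high: "\<And>t j. t \<in> I \<Longrightarrow> \<bar>LINT w|M. Z t w ^ (j + 3)\<bar> \<le> c j * d * (LINT w|M. (Z t w)\<^sup>2)"
        using S by (auto simp: small_summands_def)
      define m where "m t r = (LINT w|M. (\<Sum>u\<in>I - {t}. Z u w) ^ r)" for t r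
      define q where "q t = (LINT w|M. (Z t w)\<^sup>2)" for t
      define V where "V = (\<Sum>t\<in>I. q t)"
      have q0: "q t \<ge> 0" for t by (simp add: q_def)
      have V0: "V \<ge> 0" unfolding V_def by (simp add: q0 sum_nonneg)
      have vV: "\<bar>V - s\<bar> \<le> K * d" using v by (simp add: V_def q_def)
      have Kd: "K * d \<le> K" using d less.prems by (simp add: mult_left_le)
      have VB: "V \<le> s + K" using vV Kd by linarith
      have m: "\<bar>m t r - gauss_moment s r\<bar> \<le> C r * d" if "t \<in> I" "r < k" for t r
        unfolding m_def
      proof (rule C[OF that(2) small_summands_mono[OF S]])
        have "(\<Sum>u\<in>I - {t}. LINT w|M. (Z u w)\<^sup>2) = V - q t"
          using that I by (simp add: V_def q_def sum_diff1)
        then show "\<bar>(\<Sum>u\<in>I - {t}. LINT w|M. (Z u w)\<^sup>2) - s\<bar> \<le> (K + 1) * d"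
          using vV var[OF that(1), folded q_def] q0[of t] by (simp add: distrib_right)
      qed auto
      have mB: "\<bar>m t r\<bar> \<le> B r" if "t \<in> I" "r < k" for t r
      proof -
        have "C r * d \<le> C r" using d C0[of r] by (simp add: mult_left_le)
        then show ?thesis using m[OF that] by (simp add: B_def)
      qed
      define h where "h = (\<Sum>t\<in>I. \<Sum>j\<in>{2..l}. real (l choose j) * (LINT w|M. Z t w ^ Suc j) * m t (l - j))"
      have rec: "(LINT w|M. (\<Sum>t\<in>I. Z t w) ^ k) = h + real l * (\<Sum>t\<in>I. q t * m t (l - 1))"
      proof -
        have "(\<Sum>j\<le>l. real (l choose j) * (LINT w|M. Z t w ^ Suc j) * m t (l - j)) =
          (\<Sum>j\<in>{2..l}. real (l choose j) * (LINT w|M. Z t w ^ Suc j) * m t (l - j)) +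
          real l * (q t * m t (l - 1))" if "t \<in> I" for t
        proof (cases "l = 0")
          case True
          then show ?thesis using mean[OF that] by simp
        next
          case False
          then have "{..l} = insert 0 (insert 1 {2..l})" by auto
          then show ?thesis using mean[OF that] by (simp add: q_def power2_eq_square)
        qed
        note split = this
        have "(LINT w|M. (\<Sum>t\<in>I. Z t w) ^ k) =
          (\<Sum>t\<in>I. \<Sum>j\<le>l. real (l choose j) * (LINT w|M. Z t w ^ Suc j) * m t (l - j))"
          unfolding Suc m_def by (rule moment_sum_recurrence[OF M I indep mom])
        also have "\<dots> = (\<Sum>t\<in>I.
          (\<Sum>j\<in>{2..l}. real (l choose j) * (LINT w|M. Z t w ^ Suc j) * m t (l - j)) +
          real l * (q t * m t (l - 1)))"
          by (rule sum.cong[OF refl split])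
        also have "\<dots> = h + real l * (\<Sum>t\<in>I. q t * m t (l - 1))"
          unfolding h_def by (simp only: sum.distrib sum_distrib_left)
        finally show ?thesis .
      qed
      have "\<bar>h\<bar> \<le> (\<Sum>t\<in>I. q t * (D * d))"
        unfolding h_def
      proof (rule abs_sum_le)
        fix t assume t: "t \<in> I"
        have "\<bar>\<Sum>j\<in>{2..l}. real (l choose j) * (LINT w|M. Z t w ^ Suc j) * m t (l - j)\<bar>
          \<le> (\<Sum>j\<in>{2..l}. real (l choose j) * (c (j - 2) * d * q t) * B (l - j))"
        proof (rule abs_sum_le)
          fix j assume j: "j \<in> {2..l}"
          have "Suc j = (j - 2) + 3" using j by simp
          then have "\<bar>LINT w|M. Z t w ^ Suc j\<bar> \<le> c (j - 2) * d * q t"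
            using high[OF t, of "j - 2"] by (simp only: q_def)
          then show "\<bar>real (l choose j) * (LINT w|M. Z t w ^ Suc j) * m t (l - j)\<bar>
              \<le> real (l choose j) * (c (j - 2) * d * q t) * B (l - j)"
            unfolding abs_mult using mB[OF t, of "l - j"] Suc c d q0
            by (intro mult_mono mult_nonneg_nonneg) auto
        qed
        also have "\<dots> = q t * (D * d)"
          by (simp add: D_def sum_distrib_left sum_distrib_right mult_ac)
        finally show "\<bar>\<Sum>j\<in>{2..l}. real (l choose j) * (LINT w|M. Z t w ^ Suc j) * m t (l - j)\<bar>
          \<le> q t * (D * d)" .
      qed
      also have "\<dots> = V * (D * d)" by (simp add: V_def sum_distrib_right)
      also have "\<dots> \<le> (s + K) * (D * d)" using VB D0 d by (intro mult_right_mono) auto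
      finally have h: "\<bar>h\<bar> \<le> (s + K) * D * d" by (simp add: mult.assoc)
      have "\<bar>\<Sum>t\<in>I. q t * (m t (l - 1) - gauss_moment s (l - 1))\<bar> \<le> (\<Sum>t\<in>I. q t * (C (l - 1) * d))"
      proof (rule abs_sum_le)
        fix t assume "t \<in> I"
        then show "\<bar>q t * (m t (l - 1) - gauss_moment s (l - 1))\<bar> \<le> q t * (C (l - 1) * d)"
          using m[of t "l - 1"] q0[of t] Suc by (simp add: abs_mult mult_left_mono)
      qed
      also have "\<dots> = V * (C (l - 1) * d)" by (simp add: V_def sum_distrib_right)
      also have "\<dots> \<le> (s + K) * (C (l - 1) * d)" using VB C0 d by (intro mult_right_mono) auto
      finally have e1: "\<bar>\<Sum>t\<in>I. q t * (m t (l - 1) - gauss_moment s (l - 1))\<bar> \<le> (s + K) * C (l - 1) * d"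
        by (simp add: mult.assoc)
      have e2: "\<bar>gauss_moment s (l - 1) * (V - s)\<bar> \<le> \<bar>gauss_moment s (l - 1)\<bar> * K * d"
        unfolding abs_mult mult.assoc using vV by (intro mult_left_mono) auto
      have "(LINT w|M. (\<Sum>t\<in>I. Z t w) ^ k) - gauss_moment s k =
        h + real l * ((\<Sum>t\<in>I. q t * (m t (l - 1) - gauss_moment s (l - 1))) + gauss_moment s (l - 1) * (V - s))"
        (is "_ = h + real l * (?T + ?U)")
        unfolding rec by (simp add: Suc V_def sum_subtractf sum_distrib_right algebra_simps)
      also have "\<bar>\<dots>\<bar> \<le> (s + K) * D * d + real l * ((s + K) * C (l - 1) * d + \<bar>gauss_moment s (l - 1)\<bar> * K * d)"
      proof (rule order_trans[OF abs_triangle_ineq add_mono[OF h]])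
        show "\<bar>real l * (?T + ?U)\<bar> \<le>
            real l * ((s + K) * C (l - 1) * d + \<bar>gauss_moment s (l - 1)\<bar> * K * d)"
          unfolding abs_mult abs_of_nat
          by (intro mult_left_mono order_trans[OF abs_triangle_ineq add_mono[OF e1 e2]]) simp
      qed
      also have "\<dots> = E * d" by (simp add: E_def algebra_simps)
      finally show ?thesis .
    qed
    with E0 show ?thesis by (intro exI[of _ E] conjI allI impI)
  qed
qed

section \<open>Diagonalisation of symmetric circulant matrices\<close>

text \<open>The link function, as a function of the difference of the indices: the distance to 0 on the
  cycle of length \<open>n\<close>. That it is even and periodic is all that the diagonalisation uses.\<close>

definition cyc_dist :: "nat \<Rightarrow> int \<Rightarrow> nat" where
  "cyc_dist n d = nat (min (d mod int n) ((- d) mod int n))"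

lemma cyc_dist_minus [simp]: "cyc_dist n (- d) = cyc_dist n d"
  by (simp add: cyc_dist_def min.commute)

lemma cyc_dist_add [simp]: "cyc_dist n (d + int n) = cyc_dist n d"
proof -
  have "(- (d + int n)) mod int n = (- d) mod int n"
    using mod_add_self2[of "- (d + int n)" "int n"] by simp
  then show ?thesis by (simp add: cyc_dist_def)
qed

lemma cyc_dist_pos:
  assumes "d < n"
  shows "cyc_dist n (int d) = min d (n - d)"
proof (cases "d = 0")
  case False
  then have "(- int d) mod int n = int (n - d)"
    using assms by (simp add: zmod_zminus1_eq_if of_nat_diff)
  moreover have "int d mod int n = int d" using assms by simp
  ultimately show ?thesis unfolding cyc_dist_def by (simp only: nat_int flip: of_nat_min)
qed (simp add: cyc_dist_def)

lemma link_eq_cyc_dist: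
  assumes "j < n" "k < n"
  shows "link n (Suc j) (Suc k) = cyc_dist n (int k - int j)"
proof -
  define d where "d = (if j \<le> k then k - j else j - k)"
  have d: "d < n" using assms by (auto simp: d_def)
  have "int k - int j = int d \<or> int k - int j = - int d" by (auto simp: d_def)
  then have "cyc_dist n (int k - int j) = min d (n - d)"
    using cyc_dist_pos[OF d] cyc_dist_minus by metis
  moreover have "\<bar>real (Suc j) - real (Suc k)\<bar> = real d"
    by (auto simp: d_def)
  then have "real (link n (Suc j) (Suc k)) = real n / 2 - \<bar>real n / 2 - real d\<bar>"
    using assms by (subst real_link) auto
  then have "real (link n (Suc j) (Suc k)) = real (min d (n - d))"
    using d by (auto simp: min_def abs_if of_nat_diff)
  ultimately show ?thesis by simp
qed

lemma sum_periodic_shift: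
  fixes F :: "int \<Rightarrow> real"
  assumes "\<And>x. F (x + int n) = F x"
  shows "(\<Sum>q<n. F (int q + a)) = (\<Sum>q<n. F (int q))"
proof -
  have step: "(\<Sum>q<n. F (int q + (b + 1))) = (\<Sum>q<n. F (int q + b))" for b
  proof -
    have "(\<Sum>q<n. F (int q + (b + 1))) + F b = (\<Sum>q<Suc n. F (int q + b))"
      unfolding sum.lessThan_Suc_shift by (simp add: ac_simps)
    then show ?thesis using assms[of b] by (simp add: ac_simps)
  qed
  show ?thesis
  proof (induction a rule: int_induct[where k = 0])
    case (step1 i)
    then show ?case using step[of i] by simp
  next
    case (step2 i)
    then show ?case using step[of "i - 1"] by simp
  qed simp
qed

text \<open>The reflection \<open>q \<mapsto> n - 1 - q\<close> changes the sign of the sum, up to a shift by one.\<close>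

lemma sum_periodic_odd:
  fixes F :: "int \<Rightarrow> real"
  assumes per: "\<And>x. F (x + int n) = F x" and odd: "\<And>x. F (- x) = - F x"
  shows "(\<Sum>q<n. F (int q)) = 0"
proof -
  have "(\<Sum>q<n. F (int q)) = (\<Sum>q<n. F (int (n - Suc q)))"
    by (rule sum.nat_diff_reindex[symmetric])
  also have "\<dots> = (\<Sum>q<n. - F (int q + 1))"
  proof (rule sum.cong)
    fix q assume "q \<in> {..<n}"
    then have "int (n - Suc q) = - (int q + 1) + int n" by (simp add: of_nat_diff)
    then show "F (int (n - Suc q)) = - F (int q + 1)" using per odd by metis
  qed simp
  also have "\<dots> = - (\<Sum>q<n. F (int q))"
    using sum_periodic_shift[of F n 1, OF per] by (simp add: sum_negf)
  finally show ?thesis by simp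
qed

text \<open>The argument is kept an integer, so that periodicity modulo \<open>n\<close> can be used without any
  real arithmetic. Both functions are the real and imaginary part of a character of the cyclic group.\<close>

definition circ_cos :: "nat \<Rightarrow> int \<Rightarrow> real" where
  "circ_cos n a = cos (2 * pi * of_int a / real n)"

definition circ_sin :: "nat \<Rightarrow> int \<Rightarrow> real" where
  "circ_sin n a = sin (2 * pi * of_int a / real n)"

lemma circ_minus: "circ_cos n (- a) = circ_cos n a" "circ_sin n (- a) = - circ_sin n a"
  by (simp_all add: circ_cos_def circ_sin_def)

lemma circ_zero: "circ_cos n 0 = 1"
  by (simp add: circ_cos_def)

lemma circ_add: "circ_cos n (a + b) = circ_cos n a * circ_cos n b - circ_sin n a * circ_sin n b"
  "circ_sin n (a + b) = circ_sin n a * circ_cos n b + circ_cos n a * circ_sin n b"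
  by (simp_all add: circ_cos_def circ_sin_def distrib_left add_divide_distrib cos_add sin_add)

lemma circ_period:
  assumes "n \<ge> 1"
  shows "circ_cos n (int n * k) = 1" "circ_sin n (int n * k) = 0"
proof -
  have "2 * pi * of_int (int n * k) / real n = 2 * pi * of_int k"
    using assms by (simp add: field_simps)
  then show "circ_cos n (int n * k) = 1" "circ_sin n (int n * k) = 0"
    by (simp_all add: circ_cos_def circ_sin_def)
qed

lemma circ_add_period:
  assumes "n \<ge> 1"
  shows "circ_cos n (a + int n * k) = circ_cos n a" "circ_sin n (a + int n * k) = circ_sin n a"
  by (simp_all add: circ_add circ_period[OF assms])

lemma circ_cos_eq_1_iff:
  assumes "n \<ge> 1"
  shows "circ_cos n a = 1 \<longleftrightarrow> int n dvd a"
proof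
  assume "circ_cos n a = 1"
  then obtain k :: int where "2 * pi * of_int a / real n = k * 2 * pi"
    by (auto simp: circ_cos_def cos_one_2pi_int)
  then have "(of_int a :: real) = of_int (int n * k)"
    using assms by (simp add: field_simps)
  then show "int n dvd a" unfolding of_int_eq_iff by simp
qed (use circ_period[OF assms] in auto)

text \<open>A shift of the summation index multiplies the sum by \<open>circ_cos n r\<close>, so the sum vanishes
  unless this factor is 1.\<close>

lemma circ_cos_orthogonal:
  assumes "n \<ge> 1"
  shows "(\<Sum>m<n. circ_cos n (int m * r)) = (if int n dvd r then real n else 0)"
proof (cases "int n dvd r")
  case True
  then have "circ_cos n (int m * r) = 1" for m
    by (simp add: circ_cos_eq_1_iff[OF assms])
  then show ?thesis using True by simp
next
  case False
  let ?C = "\<Sum>m<n. circ_cos n (int m * r)"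
  have "?C = (\<Sum>m<n. circ_cos n ((int m + 1) * r))"
    by (rule sum_periodic_shift[symmetric]) (simp add: distrib_right circ_add_period[OF assms])
  also have "\<dots> = ?C * circ_cos n r - (\<Sum>m<n. circ_sin n (int m * r)) * circ_sin n r"
    by (simp add: distrib_right circ_add sum_subtractf sum_distrib_right)
  also have "(\<Sum>m<n. circ_sin n (int m * r)) = 0"
    by (rule sum_periodic_odd) (simp_all add: distrib_right circ_add_period[OF assms] circ_minus)
  finally have "?C * (1 - circ_cos n r) = 0" by (simp add: algebra_simps)
  then show ?thesis using False circ_cos_eq_1_iff[OF assms] by simp
qed

definition circ_eigenvalue :: "nat \<Rightarrow> (nat \<Rightarrow> real) \<Rightarrow> nat \<Rightarrow> real" where
  "circ_eigenvalue n x m = (\<Sum>d<n. x (cyc_dist n (int d)) * circ_cos n (int m * int d))"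

text \<open>The cosine waves are eigenvectors because the shift by \<open>j - l\<close> is expanded by the addition
  theorem and the sine part cancels, the entries being an even function of the difference.\<close>

lemma sym_circulant_eigenvector:
  assumes n: "n \<ge> 1" and j: "j < n"
  shows "(\<Sum>q<n. x (link n (Suc j) (Suc q)) * circ_cos n (int m * (int q - int l))) =
    circ_eigenvalue n x m * circ_cos n (int m * (int j - int l))"
proof -
  \<comment> \<open>The sum in terms of \<open>d = q - j\<close>, so that the shift lemma can restore the range from 0.\<close>
  define F where "F d = x (cyc_dist n d) * circ_cos n (int m * (d + (int j - int l)))" for d
  have [simp]: "int m * (d + int n) = int m * d + int n * int m"
    "int m * (d + int n + e) = int m * (d + e) + int n * int m" for d e
    by (simp_all add: algebra_simps)
  have "(\<Sum>q<n. x (link n (Suc j) (Suc q)) * circ_cos n (int m * (int q - int l))) =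
      (\<Sum>q<n. F (int q + (- int j)))"
    using j by (intro sum.cong) (auto simp: F_def link_eq_cyc_dist)
  also have "\<dots> = (\<Sum>q<n. F (int q))"
    by (rule sum_periodic_shift) (simp add: F_def circ_add_period[OF n])
  also have "\<dots> = circ_eigenvalue n x m * circ_cos n (int m * (int j - int l)) -
      (\<Sum>q<n. x (cyc_dist n (int q)) * circ_sin n (int m * int q)) * circ_sin n (int m * (int j - int l))"
    unfolding F_def circ_eigenvalue_def distrib_left circ_add sum_distrib_right sum_subtractf[symmetric]
    by (intro sum.cong refl) (simp add: right_diff_distrib)
  also have "(\<Sum>q<n. x (cyc_dist n (int q)) * circ_sin n (int m * int q)) = 0"
    by (rule sum_periodic_odd) (simp_all add: circ_add_period[OF n] circ_minus)
  finally show ?thesis by simp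
qed

lemma carrier_sc_product:
  "foldr (\<lambda>i B. sc_matrix X i n w * B) js (1\<^sub>m n) \<in> carrier_mat n n"
  by (induction js) (auto simp: sc_matrix_def sym_circulant_def)

text \<open>Since the eigenvectors do not depend on the matrix, a product of symmetric circulants is
  diagonalised by the products of the eigenvalues. Orthogonality of the waves gives the case of the
  empty product.\<close>

lemma sc_product_entry:
  assumes n: "n \<ge> 1" and "j < n" "l < n"
  shows "foldr (\<lambda>i B. sc_matrix X i n w * B) js (1\<^sub>m n) $$ (j, l) =
    (\<Sum>m<n. (\<Prod>i\<leftarrow>js. circ_eigenvalue n (\<lambda>t. X i n t w) m) * circ_cos n (int m * (int j - int l))) / real n"
  using \<open>j < n\<close>
proof (induction js arbitrary: j)
  case Nil
  have "j = l" if "int n dvd int j - int l"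
    using dvd_imp_le_int[OF _ that] Nil \<open>l < n\<close> by linarith
  then have "int n dvd int j - int l \<longleftrightarrow> j = l" by auto
  then show ?case
    using Nil n \<open>l < n\<close> by (simp add: circ_cos_orthogonal)
next
  case (Cons i js)
  let ?P = "foldr (\<lambda>i B. sc_matrix X i n w * B) js (1\<^sub>m n)"
  let ?e = "\<lambda>m. \<Prod>i\<leftarrow>js. circ_eigenvalue n (\<lambda>t. X i n t w) m"
  let ?x = "\<lambda>t. X i n t w"
  have "(sc_matrix X i n w * P) $$ (j, l) = (\<Sum>q<n. ?x (link n (Suc j) (Suc q)) * P $$ (q, l))"
    if P: "P \<in> carrier_mat n n" for P
    using carrier_matD[OF P] Cons.prems \<open>l < n\<close>
    by (simp add: sc_matrix_def sym_circulant_def scalar_prod_def atLeast0LessThan)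
  from this[OF carrier_sc_product]
  have "foldr (\<lambda>i B. sc_matrix X i n w * B) (i # js) (1\<^sub>m n) $$ (j, l) =
      (\<Sum>q<n. ?x (link n (Suc j) (Suc q)) * ?P $$ (q, l))"
    by (simp only: foldr.simps o_apply)
  also have "\<dots> = (\<Sum>q<n. \<Sum>m<n. ?e m * (?x (link n (Suc j) (Suc q)) * circ_cos n (int m * (int q - int l))) / real n)"
    by (intro sum.cong refl) (simp add: Cons.IH sum_distrib_left sum_divide_distrib mult_ac)
  also have "\<dots> = (\<Sum>m<n. ?e m * (\<Sum>q<n. ?x (link n (Suc j) (Suc q)) * circ_cos n (int m * (int q - int l))) / real n)"
    unfolding sum_distrib_left sum_divide_distrib by (rule sum.swap)
  also have "\<dots> = (\<Sum>m<n. ?e m * (circ_eigenvalue n ?x m * circ_cos n (int m * (int j - int l))) / real n)"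
    by (simp only: sym_circulant_eigenvector[OF n Cons.prems, where x = ?x])
  finally show ?case by (simp only: sum_divide_distrib list.map prod_list.Cons mult_ac)
qed

lemma trace_sc_product:
  assumes n: "n \<ge> 1"
  shows "mat_trace (foldr (\<lambda>i B. sc_matrix X i n w * B) js (1\<^sub>m n)) =
    (\<Sum>m<n. \<Prod>i\<leftarrow>js. circ_eigenvalue n (\<lambda>t. X i n t w) m)"
proof -
  have "dim_row (foldr (\<lambda>i B. sc_matrix X i n w * B) js (1\<^sub>m n)) = n"
    by (rule carrier_matD(1)[OF carrier_sc_product])
  then show ?thesis using n by (simp add: mat_trace_def sc_product_entry circ_zero)
qed

text \<open>For \<open>t \<le> n / 2\<close>, the number of points at distance \<open>t\<close> from 0 on the cycle of length \<open>n\<close>.\<close>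

definition cyc_multiplicity :: "nat \<Rightarrow> nat \<Rightarrow> real" where
  "cyc_multiplicity n t = (if t = 0 \<or> 2 * t = n then 1 else 2)"

text \<open>Folding the cycle at 0: the points \<open>t\<close> and \<open>n - t\<close> are identified, and only \<open>0\<close> and, for
  even \<open>n\<close>, \<open>n / 2\<close> have a single preimage.\<close>

lemma sum_periodic_even:
  fixes F :: "int \<Rightarrow> real"
  assumes n: "n \<ge> 1" and per: "\<And>x. F (x + int n) = F x" and even: "\<And>x. F (- x) = F x"
  shows "(\<Sum>q<n. F (int q)) = (\<Sum>t\<le>n div 2. cyc_multiplicity n t * F (int t))"
proof -
  have mirror: "F (int (n - t)) = F (int t)" if "t \<le> n" for t
    using per[of "- int t"] even[of "int t"] that by (simp add: of_nat_diff add.commute)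
  have "{..<n} = {..n div 2} \<union> {n div 2<..<n}" using n by auto
  then have "(\<Sum>q<n. F (int q)) = (\<Sum>t\<le>n div 2. F (int t)) + (\<Sum>q\<in>{n div 2<..<n}. F (int q))"
    using sum.union_disjoint[of "{..n div 2}" "{n div 2<..<n}" "\<lambda>q. F (int q)"] by fastforce
  also have "(\<Sum>q\<in>{n div 2<..<n}. F (int q)) =
      (\<Sum>t\<in>{t\<in>{..n div 2}. \<not> (t = 0 \<or> 2 * t = n)}. F (int t))"
    by (rule sum.reindex_bij_witness[of _ "\<lambda>t. n - t" "\<lambda>q. n - q"]) (auto simp: mirror simp del: of_nat_diff)
  also have "\<dots> = (\<Sum>t\<le>n div 2. if \<not> (t = 0 \<or> 2 * t = n) then F (int t) else 0)"
    by (rule sum.inter_filter) simp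
  finally have "(\<Sum>q<n. F (int q)) =
      (\<Sum>t\<le>n div 2. F (int t) + (if \<not> (t = 0 \<or> 2 * t = n) then F (int t) else 0))"
    by (simp only: sum.distrib)
  also have "\<dots> = (\<Sum>t\<le>n div 2. cyc_multiplicity n t * F (int t))"
    by (intro sum.cong) (simp_all add: cyc_multiplicity_def)
  finally show ?thesis .
qed

text \<open>This writes the eigenvalue as a sum over distinct inputs, hence over independent variables.\<close>

lemma circ_eigenvalue_half:
  assumes n: "n \<ge> 1"
  shows "circ_eigenvalue n x m =
    (\<Sum>t\<le>n div 2. cyc_multiplicity n t * circ_cos n (int m * int t) * x t)"
proof -
  have [simp]: "int m * (d + int n) = int m * d + int n * int m" for d
    by (simp add: algebra_simps)
  have "circ_eigenvalue n x m =
      (\<Sum>t\<le>n div 2. cyc_multiplicity n t * (x (cyc_dist n (int t)) * circ_cos n (int m * int t)))"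
    unfolding circ_eigenvalue_def
    by (rule sum_periodic_even[OF n]) (simp_all add: circ_add_period[OF n] circ_minus)
  also have "\<dots> = (\<Sum>t\<le>n div 2. cyc_multiplicity n t * circ_cos n (int m * int t) * x t)"
  proof (rule sum.cong)
    fix t assume "t \<in> {..n div 2}"
    then have "t < n" "t \<le> n - t" using n by auto
    then show "cyc_multiplicity n t * (x (cyc_dist n (int t)) * circ_cos n (int m * int t)) =
        cyc_multiplicity n t * circ_cos n (int m * int t) * x t"
      by (simp add: cyc_dist_pos)
  qed simp
  finally show ?thesis .
qed

text \<open>If all multiplicities were 2, the sum would be twice the sum of the squared cosines over the
  whole cycle, which is known from orthogonality at double frequency. The one or two points of
  multiplicity 1 account for the error.\<close>

lemma sum_sq_coefficients:
  assumes n: "n \<ge> 1"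
  shows "\<bar>(\<Sum>t\<le>n div 2. (cyc_multiplicity n t * circ_cos n (int m * int t))\<^sup>2) -
    (if int n dvd 2 * int m then 2 else 1) * real n\<bar> \<le> 2"
proof -
  let ?c = "\<lambda>t. circ_cos n (int m * int t)"
  have [simp]: "int m * (d + int n) = int m * d + int n * int m" for d
    by (simp add: algebra_simps)
  have double: "(?c q)\<^sup>2 = (1 + circ_cos n (int q * (2 * int m))) / 2" for q
  proof -
    have "circ_cos n (int q * (2 * int m)) = cos (2 * (2 * pi * of_int (int m * int q) / real n))"
      by (simp add: circ_cos_def field_simps)
    then show ?thesis unfolding cos_double_cos by (simp add: circ_cos_def)
  qed
  have "(\<Sum>t\<le>n div 2. cyc_multiplicity n t * (?c t)\<^sup>2) = (\<Sum>q<n. (?c q)\<^sup>2)"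
    by (rule sum_periodic_even[symmetric, OF n, of "\<lambda>d. (circ_cos n (int m * d))\<^sup>2"])
      (simp_all add: circ_add_period[OF n] circ_minus)
  also have "\<dots> = (real n + (\<Sum>q<n. circ_cos n (int q * (2 * int m)))) / 2"
    by (simp add: double sum.distrib flip: sum_divide_distrib)
  finally have main: "2 * (\<Sum>t\<le>n div 2. cyc_multiplicity n t * (?c t)\<^sup>2) =
      (if int n dvd 2 * int m then 2 else 1) * real n"
    unfolding circ_cos_orthogonal[OF n] by (simp split: if_splits)
  define r where "r = (\<Sum>t\<in>{t\<in>{..n div 2}. t = 0 \<or> 2 * t = n}. (?c t)\<^sup>2)"
  have "(\<Sum>t\<le>n div 2. (cyc_multiplicity n t * ?c t)\<^sup>2) =
      (\<Sum>t\<le>n div 2. 2 * (cyc_multiplicity n t * (?c t)\<^sup>2) - (if t = 0 \<or> 2 * t = n then (?c t)\<^sup>2 else 0))"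
    by (intro sum.cong) (auto simp: cyc_multiplicity_def power_mult_distrib)
  also have "\<dots> = 2 * (\<Sum>t\<le>n div 2. cyc_multiplicity n t * (?c t)\<^sup>2) - r"
    unfolding r_def by (simp only: sum_subtractf sum_distrib_left sum.inter_filter finite_atMost)
  finally have eq: "(\<Sum>t\<le>n div 2. (cyc_multiplicity n t * ?c t)\<^sup>2) =
      (if int n dvd 2 * int m then 2 else 1) * real n - r"
    using main by simp
  have "r \<le> (\<Sum>t\<in>{t\<in>{..n div 2}. t = 0 \<or> 2 * t = n}. 1)"
    unfolding r_def by (intro sum_mono) (simp add: circ_cos_def abs_square_le_1)
  also have "\<dots> \<le> real (card {0, n div 2})"
    by simp (rule card_mono; auto)
  also have "\<dots> \<le> 2" by (simp add: card_insert_if)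
  finally have "r \<le> 2" .
  moreover  have "r \<ge> 0" unfolding r_def by (intro sum_nonneg) simp
  ultimately show ?thesis using eq by simp
qed

section \<open>Limits of the eigenvalue moments\<close>

text \<open>Used with singleton blocks for the summands of one eigenvalue, and with one block per matrix
  for the eigenvalues of different matrices.\<close>

lemma indep_vars_linear_blocks:
  fixes X :: "'i \<Rightarrow> 'w \<Rightarrow> real"
  assumes M: "prob_space M" and indep: "prob_space.indep_vars M (\<lambda>_. borel) X I"
    and K: "\<And>j. j \<in> L \<Longrightarrow> K j \<subseteq> I" and disj: "disjoint_family_on K L"
  shows "prob_space.indep_vars M (\<lambda>_. borel) (\<lambda>j w. \<Sum>i\<in>K j. b i * X i w) L"
proof -
  interpret prob_space M by fact
  have "indep_vars (\<lambda>_. borel)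
      (\<lambda>j w. (\<lambda>f. \<Sum>i\<in>K j. b i * f i) (restrict (\<lambda>i. X i w) (K j))) L"
  proof (rule indep_vars_compose2[OF indep_vars_restrict[OF indep K disj]])
    show "(\<lambda>f. \<Sum>i\<in>K j. b i * f i) \<in> borel_measurable (Pi\<^sub>M (K j) (\<lambda>_. borel))" for j
      by (intro borel_measurable_sum borel_measurable_times borel_measurable_const
          measurable_component_singleton)
  qed
  then show ?thesis by simp
qed

lemma prod_list_eq_prod_count:
  fixes f :: "'a \<Rightarrow> 'b :: comm_monoid_mult"
  assumes "finite I" "set js \<subseteq> I"
  shows "(\<Prod>i\<leftarrow>js. f i) = (\<Prod>i\<in>I. f i ^ count_list js i)"
  using assms(2)
proof (induction js)
  case (Cons x js)
  have "(\<Prod>i\<in>I. f i ^ count_list (x # js) i) =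
      (\<Prod>i\<in>I. (if i = x then f i else 1) * f i ^ count_list js i)"
    by (intro prod.cong) auto
  also have "\<dots> = f x * (\<Prod>i\<in>I. f i ^ count_list js i)"
    using Cons.prems assms(1) by (simp add: prod.distrib)
  finally show ?case using Cons by simp
qed simp

lemma expectation_indep_prod_list:
  fixes Y :: "'i \<Rightarrow> 'w \<Rightarrow> real"
  assumes M: "prob_space M" and I: "finite I"
    and indep: "prob_space.indep_vars M (\<lambda>_. borel) Y I"
    and mom: "\<And>i. i \<in> I \<Longrightarrow> has_moments M (Y i)" and js: "set js \<subseteq> I"
  shows "(LINT w|M. (\<Prod>i\<leftarrow>js. Y i w)) = (\<Prod>i\<in>I. LINT w|M. Y i w ^ count_list js i)"
proof -
  interpret prob_space M by fact
  have "indep_vars (\<lambda>_. borel) (\<lambda>i w. Y i w ^ count_list js i) I"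
    by (rule indep_vars_compose2[OF indep]) (intro borel_measurable_power measurable_ident_sets refl)
  moreover have "integrable M (\<lambda>w. Y i w ^ count_list js i)" if "i \<in> I" for i
    by (intro has_moments_integrable has_moments_power M mom that)
  ultimately show ?thesis
    unfolding prod_list_eq_prod_count[OF I js]
    using indep_vars_lebesgue_integral[OF I] by blast
qed

lemma has_moments_prod_list:
  assumes "prob_space M" "\<And>i. i \<in> set js \<Longrightarrow> has_moments M (Y i)"
  shows "has_moments M (\<lambda>w. \<Prod>i\<leftarrow>js. Y i w)"
  using assms(2)
proof (induction js)
  case Nil
  then show ?case by (simp add: finite_moments_const assms(1))
next
  case (Cons i js)
  then show ?case
    using has_moments_mult[where f = "Y i" and g = "\<lambda>w. \<Prod>i\<leftarrow>js. Y i w"] by simp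
qed

text \<open>Every input occurs in the first row, so that the moment bounds, which are stated for matrix
  entries, hold for all inputs.\<close>

lemma link_first_row:
  assumes "n \<ge> 1" "t \<le> n div 2"
  shows "link n 1 (Suc t) = t" "Suc t \<le> n"
proof -
  show "Suc t \<le> n" using assms by linarith
  then have "t < n" "t \<le> n - t" using assms by auto
  then show "link n 1 (Suc t) = t"
    using link_eq_cyc_dist[of 0 n t] cyc_dist_pos[of t n] by simp
qed

lemma assumption_I_summands:
  assumes "assumption_I p M X"
  obtains c :: "nat \<Rightarrow> real" where "\<And>j. c j \<ge> 0"
    "\<And>n i t. n \<ge> 1 \<Longrightarrow> i \<in> {1..p} \<Longrightarrow> t \<le> n div 2 \<Longrightarrow>
      has_moments (M n) (X i n t) \<and> (LINT w|M n. X i n t w) = 0 \<and> (LINT w|M n. (X i n t w)\<^sup>2) = 1 \<and>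
      (\<forall>j. \<bar>LINT w|M n. X i n t w ^ (j + 3)\<bar> \<le> c j)"
proof -
  have base: "prob_space (M n)"
    "prob_space.indep_vars (M n) (\<lambda>_. borel) (\<lambda>(i, t). X i n t) ({1..p} \<times> {t. real t \<le> real n / 2})"
    "\<And>i t. i \<in> {1..p} \<Longrightarrow> real t \<le> real n / 2 \<Longrightarrow>
      (LINT w|M n. X i n t w) = 0 \<and> prob_space.variance (M n) (X i n t) = 1" if "n \<ge> 1" for n
    using assms that unfolding assumption_I_def by blast+
  have "\<exists>c::real. \<forall>n\<ge>1. \<forall>i\<in>{1..p}. \<forall>m l. 1 \<le> m \<and> m \<le> l \<and> l \<le> n \<longrightarrow>
        integrable (M n) (\<lambda>w. \<bar>X i n (link n m l) w\<bar> ^ k) \<and>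
        prob_space.expectation (M n) (\<lambda>w. \<bar>X i n (link n m l) w\<bar> ^ k) \<le> c" if "k \<ge> 1" for k
    using assms that unfolding assumption_I_def by blast
  then obtain c where c: "\<And>k n i m l. k \<ge> 1 \<Longrightarrow> n \<ge> 1 \<Longrightarrow> i \<in> {1..p} \<Longrightarrow> 1 \<le> m \<Longrightarrow> m \<le> l \<Longrightarrow> l \<le> n \<Longrightarrow>
        integrable (M n) (\<lambda>w. \<bar>X i n (link n m l) w\<bar> ^ k) \<and>
        prob_space.expectation (M n) (\<lambda>w. \<bar>X i n (link n m l) w\<bar> ^ k) \<le> c k"
    by metis
  show thesis
  proof (rule that[of "\<lambda>j. \<bar>c (j + 3)\<bar>"])
    fix n i t :: nat assume n: "n \<ge> 1" and i: "i \<in> {1..p}" and t: "t \<le> n div 2"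
    interpret prob_space "M n" using base(1)[OF n] .
    have t': "real t \<le> real n / 2" using t by linarith
    have abs: "integrable (M n) (\<lambda>w. \<bar>X i n t w\<bar> ^ k)" "(LINT w|M n. \<bar>X i n t w\<bar> ^ k) \<le> c k"
      if "k \<ge> 1" for k
      using c[OF that n i, of 1 "Suc t"] link_first_row[OF n t] by auto
    have "X i n t \<in> borel_measurable (M n)"
      using base(2)[OF n] i t' by (auto simp: indep_vars_def)
    moreover have "integrable (M n) (\<lambda>w. \<bar>X i n t w\<bar> ^ k)" for k
      using abs(1)[of k] by (cases k) auto
    ultimately have mom: "has_moments (M n) (X i n t)"
      by (simp add: has_moments_iff)
    have mean: "(LINT w|M n. X i n t w) = 0" using base(3)[OF n i t'] by simp
    have "(LINT w|M n. (X i n t w)\<^sup>2) = 1"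
      using base(3)[OF n i t'] by (simp add: mean)
    moreover have "\<bar>LINT w|M n. X i n t w ^ (j + 3)\<bar> \<le> \<bar>c (j + 3)\<bar>" for j
    proof -
      have "\<bar>LINT w|M n. X i n t w ^ (j + 3)\<bar> \<le> (LINT w|M n. \<bar>X i n t w ^ (j + 3)\<bar>)"
        by (rule integral_abs_bound)
      then show ?thesis using abs(2)[of "j + 3"] by (simp add: power_abs)
    qed
    ultimately show "has_moments (M n) (X i n t) \<and> (LINT w|M n. X i n t w) = 0 \<and>
      (LINT w|M n. (X i n t w)\<^sup>2) = 1 \<and> (\<forall>j. \<bar>LINT w|M n. X i n t w ^ (j + 3)\<bar> \<le> \<bar>c (j + 3)\<bar>)"
      using mom mean by blast
  qed simp
qed

definition circ_weight :: "nat \<Rightarrow> nat \<Rightarrow> nat \<Rightarrow> real" where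
  "circ_weight n m t = cyc_multiplicity n t * circ_cos n (int m * int t) / sqrt (real n)"

definition scaled_eigenvalue ::
    "(nat \<Rightarrow> nat \<Rightarrow> nat \<Rightarrow> 'w \<Rightarrow> real) \<Rightarrow> nat \<Rightarrow> nat \<Rightarrow> nat \<Rightarrow> 'w \<Rightarrow> real" where
  "scaled_eigenvalue X n m i w = circ_eigenvalue n (\<lambda>t. X i n t w) m / sqrt (real n)"

lemma scaled_eigenvalue_half:
  "n \<ge> 1 \<Longrightarrow> scaled_eigenvalue X n m i w = (\<Sum>t\<le>n div 2. circ_weight n m t * X i n t w)"
  by (simp add: scaled_eigenvalue_def circ_eigenvalue_half circ_weight_def sum_divide_distrib)

lemma abs_circ_weight_le: "\<bar>circ_weight n m t\<bar> \<le> 2 / sqrt (real n)"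
proof -
  have "\<bar>cyc_multiplicity n t\<bar> * \<bar>circ_cos n (int m * int t)\<bar> \<le> 2 * 1"
    by (intro mult_mono) (auto simp: cyc_multiplicity_def circ_cos_def)
  then show ?thesis
    by (simp add: circ_weight_def abs_mult divide_right_mono)
qed

text \<open>The squared wave averages to \<open>1 / 2\<close> over the cycle, unless \<open>m = 0\<close> or \<open>m = n / 2\<close>, where
  it is constantly 1.\<close>

definition limit_variance :: "nat \<Rightarrow> nat \<Rightarrow> real" where
  "limit_variance n m = (if int n dvd 2 * int m then 2 else 1)"

lemma sum_sq_circ_weight:
  assumes "n \<ge> 1"
  shows "\<bar>(\<Sum>t\<le>n div 2. (circ_weight n m t)\<^sup>2) - limit_variance n m\<bar> \<le> 2 / real n"
proof -
  let ?S = "\<Sum>t\<le>n div 2. (cyc_multiplicity n t * circ_cos n (int m * int t))\<^sup>2"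
  have "(\<Sum>t\<le>n div 2. (circ_weight n m t)\<^sup>2) - limit_variance n m =
      (?S - limit_variance n m * real n) / real n"
    using assms by (simp add: circ_weight_def power_divide diff_divide_distrib flip: sum_divide_distrib)
  also have "\<bar>\<dots>\<bar> \<le> 2 / real n"
    using sum_sq_coefficients[OF assms, of m] by (simp add: limit_variance_def divide_right_mono)
  finally show ?thesis .
qed

lemma assumption_I_indep:
  assumes "assumption_I p M X" and "n \<ge> 1"
  shows "prob_space (M n)"
    and "prob_space.indep_vars (M n) (\<lambda>_. borel) (\<lambda>(i, t). X i n t) ({1..p} \<times> {..n div 2})"
proof -
  have "{t. real t \<le> real n / 2} = {..n div 2}" by (auto simp: field_simps)
  then show "prob_space (M n)"
    "prob_space.indep_vars (M n) (\<lambda>_. borel) (\<lambda>(i, t). X i n t) ({1..p} \<times> {..n div 2})"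
    using assms unfolding assumption_I_def by auto
qed

lemma has_moments_input:
  assumes I: "assumption_I p M X" and n: "n \<ge> 1" and i: "i \<in> {1..p}" and t: "t \<le> n div 2"
  shows "has_moments (M n) (X i n t)"
  by (rule assumption_I_summands[OF I]) (use n i t in blast)

lemma indep_vars_weighted_inputs:
  assumes I: "assumption_I p M X" and n: "n \<ge> 1" and "i \<in> {1..p}"
  shows "prob_space.indep_vars (M n) (\<lambda>_. borel) (\<lambda>t w. circ_weight n m t * X i n t w) {..n div 2}"
  using indep_vars_linear_blocks[OF assumption_I_indep[OF I n], of "{..n div 2}" "\<lambda>t. {(i, t)}"
      "\<lambda>(i, t). circ_weight n m t"] \<open>i \<in> {1..p}\<close>
  by (simp add: disjoint_family_on_def)

lemma indep_vars_scaled_eigenvalue: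
  assumes I: "assumption_I p M X" and n: "n \<ge> 1"
  shows "prob_space.indep_vars (M n) (\<lambda>_. borel) (scaled_eigenvalue X n m) {1..p}"
proof -
  have "prob_space.indep_vars (M n) (\<lambda>_. borel)
      (\<lambda>i w. \<Sum>q\<in>{i} \<times> {..n div 2}. (\<lambda>(i, t). circ_weight n m t) q * (\<lambda>(i, t). X i n t) q w) {1..p}"
    by (rule indep_vars_linear_blocks[OF assumption_I_indep[OF I n]]) (auto simp: disjoint_family_on_def)
  also have "(\<lambda>i w. \<Sum>q\<in>{i} \<times> {..n div 2}. (\<lambda>(i, t). circ_weight n m t) q * (\<lambda>(i, t). X i n t) q w) =
      scaled_eigenvalue X n m"
    by (intro ext) (simp add: scaled_eigenvalue_half[OF n] sum.cartesian_product')
  finally show ?thesis .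
qed

lemma has_moments_scaled_eigenvalue:
  assumes I: "assumption_I p M X" and n: "n \<ge> 1" and i: "i \<in> {1..p}"
  shows "has_moments (M n) (scaled_eigenvalue X n m i)"
proof -
  note M = assumption_I_indep(1)[OF I n]
  have "has_moments (M n) (\<lambda>w. circ_weight n m t * X i n t w)" if "t \<le> n div 2" for t
    by (rule has_moments_cmult[OF M has_moments_input[OF I n i that]])
  then have "has_moments (M n) (\<lambda>w. \<Sum>t\<le>n div 2. circ_weight n m t * X i n t w)"
    by (rule has_moments_sum[OF M]) (simp only: atMost_iff)
  then show ?thesis by (simp add: scaled_eigenvalue_half[OF n])
qed

text \<open>The bound is uniform in the frequency; this is what allows averaging over the spectrum.\<close>

lemma scaled_eigenvalue_moment:
  fixes M :: "nat \<Rightarrow> 'w measure"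
  assumes I: "assumption_I p M X" and "s \<ge> 0"
  obtains C where "C \<ge> 0" "\<And>n m i. n \<ge> 4 \<Longrightarrow> i \<in> {1..p} \<Longrightarrow> limit_variance n m = s \<Longrightarrow>
    \<bar>(LINT w|M n. scaled_eigenvalue X n m i w ^ k) - gauss_moment s k\<bar> \<le> C * (2 / sqrt (real n))"
proof -
  obtain c :: "nat \<Rightarrow> real" where c0: "\<And>j. c j \<ge> 0" and
    c: "\<And>n i t. n \<ge> 1 \<Longrightarrow> i \<in> {1..p} \<Longrightarrow> t \<le> n div 2 \<Longrightarrow>
      has_moments (M n) (X i n t) \<and> (LINT w|M n. X i n t w) = 0 \<and> (LINT w|M n. (X i n t w)\<^sup>2) = 1 \<and>
      (\<forall>j. \<bar>LINT w|M n. X i n t w ^ (j + 3)\<bar> \<le> c j)"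
    using assumption_I_summands[OF I] by blast
  obtain C where C0: "C \<ge> 0" and C: "\<And>(M :: 'w measure) (Z :: nat \<Rightarrow> 'w \<Rightarrow> real) d J.
    small_summands c M Z d J \<Longrightarrow> \<bar>(\<Sum>t\<in>J. LINT w|M. (Z t w)\<^sup>2) - s\<bar> \<le> 1 * d \<Longrightarrow>
    \<bar>(LINT w|M. (\<Sum>t\<in>J. Z t w) ^ k) - gauss_moment s k\<bar> \<le> C * d"
    using moment_central_limit[where c = c and s = s and K = 1 and k = k and ?'w = 'w and ?'i = nat] \<open>s \<ge> 0\<close> c0
    by (metis zero_le_one)
  show thesis
  proof (rule that[OF C0])
    fix n m i assume n4: "n \<ge> 4" and i: "i \<in> {1..p}" and s: "limit_variance n m = s"
    have n: "n \<ge> 1" using n4 by simp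
    define d where "d = 2 / sqrt (real n)"
    define b where "b = circ_weight n m"
    have "sqrt 4 \<le> sqrt (real n)" using n4 by (intro real_sqrt_le_mono) simp
    then have d: "0 \<le> d" "d \<le> 1" using n4 by (simp_all add: d_def divide_le_eq_1)
    have dd: "d\<^sup>2 = 4 / real n" by (simp add: d_def power_divide)
    have b: "\<bar>b t\<bar> \<le> d" for t using abs_circ_weight_le by (simp add: b_def d_def)
    have bb: "(b t)\<^sup>2 \<le> d" for t
    proof -
      have "(b t)\<^sup>2 \<le> d\<^sup>2" using b[of t] by (simp add: abs_le_square_iff[symmetric] d)
      also have "\<dots> \<le> d" using d by (simp add: power2_eq_square mult_left_le)
      finally show ?thesis .
    qed
    let ?Z = "\<lambda>t w. b t * X i n t w"
    have mom: "has_moments (M n) (?Z t) \<and> (LINT w|M n. ?Z t w) = 0 \<and> (LINT w|M n. (?Z t w)\<^sup>2) = (b t)\<^sup>2 \<and>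
      (\<forall>j. \<bar>LINT w|M n. ?Z t w ^ (j + 3)\<bar> \<le> c j * d * (b t)\<^sup>2)" if t: "t \<le> n div 2" for t
    proof (intro conjI allI)
      note X = c[OF n i t]
      show "has_moments (M n) (?Z t)"
        using X by (intro has_moments_cmult assumption_I_indep(1)[OF I n]) blast
      show "(LINT w|M n. ?Z t w) = 0" "(LINT w|M n. (?Z t w)\<^sup>2) = (b t)\<^sup>2"
        using X by (simp_all add: power_mult_distrib)
      fix j
      have "\<bar>b t\<bar> ^ Suc j \<le> d"
        using b[of t] d mult_mono[OF b[of t] power_le_one[of "\<bar>b t\<bar>" j]] by simp
      then have "\<bar>b t\<bar> ^ Suc j * (b t)\<^sup>2 \<le> d * (b t)\<^sup>2" by (rule mult_right_mono) simp
      moreover have "\<bar>b t\<bar> ^ (j + 3) = \<bar>b t\<bar> ^ Suc j * (b t)\<^sup>2"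
        by (simp add: power_add numeral_eq_Suc)
      ultimately have "\<bar>b t\<bar> ^ (j + 3) * \<bar>LINT w|M n. X i n t w ^ (j + 3)\<bar> \<le> (d * (b t)\<^sup>2) * c j"
        using X by (intro mult_mono) (auto simp: d)
      then show "\<bar>LINT w|M n. ?Z t w ^ (j + 3)\<bar> \<le> c j * d * (b t)\<^sup>2"
        by (simp add: power_mult_distrib abs_mult power_abs mult_ac del: power_Suc)
    qed
    have "small_summands c (M n) ?Z d {..n div 2}"
      unfolding small_summands_def
      using assumption_I_indep(1)[OF I n] indep_vars_weighted_inputs[OF I n i, of m] d mom bb
      by (simp add: b_def)
    moreover have "\<bar>(\<Sum>t\<le>n div 2. LINT w|M n. (?Z t w)\<^sup>2) - s\<bar> \<le> 1 * d"
    proof -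
      have "(\<Sum>t\<le>n div 2. LINT w|M n. (?Z t w)\<^sup>2) = (\<Sum>t\<le>n div 2. (b t)\<^sup>2)"
        using mom by (intro sum.cong) auto
      moreover have "2 / real n \<le> d"
      proof -
        have "2 / real n \<le> d\<^sup>2" unfolding dd by (intro divide_right_mono) auto
        also have "\<dots> \<le> d" using d by (simp add: power2_eq_square mult_left_le)
        finally show ?thesis .
      qed
      ultimately show ?thesis
        using sum_sq_circ_weight[OF n, of m] by (simp add: b_def s)
    qed
    ultimately show "\<bar>(LINT w|M n. scaled_eigenvalue X n m i w ^ k) - gauss_moment s k\<bar> \<le> C * (2 / sqrt (real n))"
      using C[of "M n" ?Z d "{..n div 2}"] by (simp add: scaled_eigenvalue_half[OF n] b_def d_def)
  qed
qed

lemma gauss_moment_std: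
  "gauss_moment 1 (2 * k) = fact (2 * k) / (2 ^ k * fact k)" "gauss_moment 1 (Suc (2 * k)) = 0"
proof (induction k)
  case (Suc k)
  case 1
  have "gauss_moment 1 (2 * Suc k) = real (2 * k + 1) * (fact (2 * k) / (2 ^ k * fact k))"
    using Suc by simp
  also have "\<dots> = fact (2 * Suc k) / (2 ^ Suc k * fact (Suc k))"
  proof -
    have "(fact (2 * Suc k) :: real) = 2 * real (k + 1) * (real (2 * k + 1) * fact (2 * k))"
      by (simp add: algebra_simps)
    moreover have "(2 ^ Suc k * fact (Suc k) :: real) = 2 * real (k + 1) * (2 ^ k * fact k)"
      by simp
    moreover have "2 * real (k + 1) \<noteq> 0" by simp
    note mult_divide_mult_cancel_left[OF this]
    ultimately show ?thesis
      by (simp only: times_divide_eq_right)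
  qed
  finally show ?case .
  case 2
  show ?case using Suc by simp
qed simp_all

lemma std_normal_moments:
  assumes N: "prob_space N" and a: "distributed N lborel f (\<lambda>x. ennreal (std_normal_density x))"
  shows "has_moments N f" and "(LINT w|N. f w ^ k) = gauss_moment 1 k"
proof -
  have "f \<in> borel_measurable N"
    using distributed_measurable[OF a] by simp
  moreover have "integrable N (\<lambda>w. \<bar>f w\<bar> ^ k)" for k
    using distributed_integrable[OF a, of "\<lambda>x. \<bar>x\<bar> ^ k"] integrable_std_normal_moment_abs[of k] by simp
  ultimately show "has_moments N f" by (simp add: has_moments_iff)
  have "(LINT w|N. f w ^ k) = (LINT x|lborel. std_normal_density x * x ^ k)"
    using distributed_integral[OF a, of "\<lambda>x. x ^ k"] by simp
  also have "\<dots> = gauss_moment 1 k"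
  proof (cases "even k")
    case True
    then show ?thesis
      by (auto elim!: evenE simp: gauss_moment_std integral_std_normal_moment_even)
  next
    case False
    then obtain l where "k = 2 * l + 1" by (rule oddE)
    then show ?thesis
      using integral_std_normal_moment_odd[of l] gauss_moment_std(2)[of l] by simp
  qed
  finally show "(LINT w|N. f w ^ k) = gauss_moment 1 k" .
qed

text \<open>Uniformity in \<open>m\<close> survives the product over the matrices because the limit is taken along a
  filter on pairs \<open>(n, m)\<close> in which only \<open>n\<close> tends to infinity.\<close>

lemma eigenvalue_word_limit:
  assumes I: "assumption_I p M X" and js: "set js \<subseteq> {1..p}" and "s \<ge> 0" "e > 0"
  shows "\<forall>\<^sub>F n in sequentially. \<forall>m. limit_variance n m = s \<longrightarrow>
    \<bar>(LINT w|M n. (\<Prod>i\<leftarrow>js. scaled_eigenvalue X n m i w)) -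
      (\<Prod>i\<in>{1..p}. gauss_moment s (count_list js i))\<bar> < e"
proof -
  define F where "F = inf (filtercomap fst sequentially) (principal {(n, m). limit_variance n m = s})"
  have fst: "filterlim fst sequentially F"
    unfolding F_def by (rule filterlim_mono[OF filterlim_filtercomap]) auto
  have lim: "((\<lambda>(n, m). (LINT w|M n. scaled_eigenvalue X n m i w ^ k)) \<longlongrightarrow> gauss_moment s k) F"
    if i: "i \<in> {1..p}" for i k
  proof (rule scaled_eigenvalue_moment[OF I \<open>s \<ge> 0\<close>, of k])
    fix C
    assume C: "\<And>n m i. n \<ge> 4 \<Longrightarrow> i \<in> {1..p} \<Longrightarrow> limit_variance n m = s \<Longrightarrow>
      \<bar>(LINT w|M n. scaled_eigenvalue X n m i w ^ k) - gauss_moment s k\<bar> \<le> C * (2 / sqrt (real n))"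
    have "(\<lambda>n. C * (2 / sqrt (real n))) \<longlonglongrightarrow> 0"
      by real_asymp
    from filterlim_compose[OF this fst]
    have "((\<lambda>q. C * (2 / sqrt (real (fst q)))) \<longlongrightarrow> 0) F" .
    moreover have "\<forall>\<^sub>F q in F. norm ((case q of (n, m) \<Rightarrow> (LINT w|M n. scaled_eigenvalue X n m i w ^ k)) -
        gauss_moment s k) \<le> C * (2 / sqrt (real (fst q)))"
    proof -
      have "\<forall>\<^sub>F q in filtercomap fst sequentially. fst q \<ge> (4::nat)"
        by (intro eventually_filtercomapI eventually_ge_at_top)
      then show ?thesis
        unfolding F_def eventually_inf_principal by eventually_elim (use C[OF _ i] in auto)
    qed
    ultimately have "((\<lambda>q. (case q of (n, m) \<Rightarrow> (LINT w|M n. scaled_eigenvalue X n m i w ^ k)) -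
        gauss_moment s k) \<longlongrightarrow> 0) F"
      by (rule Lim_null_comparison[rotated])
    then show ?thesis by (rule LIM_zero_cancel)
  qed
  have "((\<lambda>q. \<Prod>i\<in>{1..p}. case q of (n, m) \<Rightarrow> (LINT w|M n. scaled_eigenvalue X n m i w ^ count_list js i)) \<longlongrightarrow>
      (\<Prod>i\<in>{1..p}. gauss_moment s (count_list js i))) F"
    by (intro tendsto_prod lim)
  then have "\<forall>\<^sub>F q in F. dist (\<Prod>i\<in>{1..p}. case q of (n, m) \<Rightarrow> (LINT w|M n. scaled_eigenvalue X n m i w ^ count_list js i))
      (\<Prod>i\<in>{1..p}. gauss_moment s (count_list js i)) < e"
    using \<open>e > 0\<close> by (rule tendstoD)
  then obtain Q where Q: "eventually Q sequentially" and lim_Q: "\<And>n m. Q n \<Longrightarrow> limit_variance n m = s \<Longrightarrow>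
      \<bar>(\<Prod>i\<in>{1..p}. (LINT w|M n. scaled_eigenvalue X n m i w ^ count_list js i)) -
      (\<Prod>i\<in>{1..p}. gauss_moment s (count_list js i))\<bar> < e"
    unfolding F_def eventually_inf_principal eventually_filtercomap by (auto simp: dist_real_def)
  from Q eventually_ge_at_top[of "1::nat"] show ?thesis
  proof eventually_elim
    case (elim n)
    then show ?case
      using lim_Q expectation_indep_prod_list[OF assumption_I_indep(1)[OF I elim(2)] _
          indep_vars_scaled_eigenvalue[OF I elim(2)] has_moments_scaled_eigenvalue[OF I elim(2)] js]
      by simp
  qed
qed

lemma card_limit_variance:
  assumes "n \<ge> 1"
  shows "card {m. m < n \<and> limit_variance n m \<noteq> 1} \<le> 2"
proof -
  have "m \<in> {0, n div 2}" if "m < n" "limit_variance n m \<noteq> 1" for m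
  proof -
    have "n dvd 2 * m"
      using that(2) int_dvd_int_iff[of n "2 * m"] by (auto simp: limit_variance_def split: if_splits)
    then obtain k where k: "2 * m = n * k" by (auto simp: dvd_def)
    then have "n * k < n * 2" using that(1) by linarith
    then have "k < 2" unfolding mult_less_cancel1 by (rule conjunct2)
    then have "k = 0 \<or> k = 1" by auto
    then show ?thesis using k by auto
  qed
  then have "card {m. m < n \<and> limit_variance n m \<noteq> 1} \<le> card {0, n div 2}"
    by (intro card_mono) auto
  also have "\<dots> \<le> 2" by (simp add: card_insert_if)
  finally show ?thesis .
qed

text \<open>A bounded number of terms, each of bounded size, disappears in the average.\<close>

lemma average_limit:
  fixes f :: "nat \<Rightarrow> nat \<Rightarrow> real"
  assumes good: "\<And>e. e > 0 \<Longrightarrow> \<forall>\<^sub>F n in sequentially. \<forall>m. m \<notin> E n \<longrightarrow> \<bar>f n m - L\<bar> < e"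
    and bad: "\<forall>\<^sub>F n in sequentially. \<forall>m\<in>E n. \<bar>f n m - L\<bar> \<le> B"
    and card: "\<And>n. n \<ge> 1 \<Longrightarrow> card {m. m < n \<and> m \<in> E n} \<le> r"
  shows "(\<lambda>n. (\<Sum>m<n. f n m) / real n) \<longlonglongrightarrow> L"
proof (rule tendstoI)
  fix e :: real assume e: "e > 0"
  have "(\<lambda>n. real r * \<bar>B\<bar> / real n) \<longlonglongrightarrow> 0" by real_asymp
  then have "\<forall>\<^sub>F n in sequentially. real r * \<bar>B\<bar> / real n < e / 2"
    using e by (intro order_tendstoD) auto
  moreover have "\<forall>\<^sub>F n in sequentially. \<forall>m. m \<notin> E n \<longrightarrow> \<bar>f n m - L\<bar> < e / 2"
    using e by (intro good) simp
  ultimately show "\<forall>\<^sub>F n in sequentially. dist ((\<Sum>m<n. f n m) / real n) L < e"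
    using bad eventually_ge_at_top[of 1]
  proof eventually_elim
    case (elim n)
    have "\<bar>\<Sum>m<n. f n m - L\<bar> \<le> (\<Sum>m<n. e / 2 + (if m \<in> E n then \<bar>B\<bar> else 0))"
    proof (rule abs_sum_le)
      fix m
      show "\<bar>f n m - L\<bar> \<le> e / 2 + (if m \<in> E n then \<bar>B\<bar> else 0)"
        using elim(2,3) e by (cases "m \<in> E n") (force intro: less_imp_le)+
    qed
    also have "\<dots> = real n * (e / 2) + real (card {m. m < n \<and> m \<in> E n}) * \<bar>B\<bar>"
      by (simp add: sum.distrib Int_def conj_commute flip: sum.inter_filter)
    also have "\<dots> \<le> real n * (e / 2) + real r * \<bar>B\<bar>"
      using card[OF elim(4)] by (intro add_left_mono mult_right_mono) auto
    finally have "\<bar>\<Sum>m<n. f n m - L\<bar> / real n \<le> (real n * (e / 2) + real r * \<bar>B\<bar>) / real n"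
      by (rule divide_right_mono) simp
    also have "\<dots> = e / 2 + real r * \<bar>B\<bar> / real n"
      using elim(4) by (simp add: add_divide_distrib)
    also have "\<dots> < e" using elim(1) by linarith
    finally have "\<bar>\<Sum>m<n. f n m - L\<bar> / real n < e" .
    moreover have "(\<Sum>m<n. f n m) / real n - L = (\<Sum>m<n. f n m - L) / real n"
      using elim(4) by (simp add: sum_subtractf field_simps)
    ultimately show ?case by (simp add: dist_real_def abs_divide)
  qed
qed

text \<open>At the exceptional frequencies the moments converge too, to those of variance 2; only their
  boundedness matters.\<close>

lemma trace_word_limit:
  fixes a :: "nat \<Rightarrow> 'v \<Rightarrow> real"
  assumes I: "assumption_I p M X" and N: "prob_space N"
    and a: "prob_space.indep_vars N (\<lambda>_. borel) a {1..p}"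
      "\<And>i. i \<in> {1..p} \<Longrightarrow> distributed N lborel (a i) (\<lambda>x. ennreal (std_normal_density x))"
    and js: "set js \<subseteq> {1..p}"
  shows "(\<lambda>n. (LINT w|M n. mat_trace (foldr (\<lambda>i B. sc_matrix X i n w * B) js (1\<^sub>m n))) /
      (real n * sqrt (real n) ^ length js)) \<longlonglongrightarrow> (LINT w|N. (\<Prod>i\<leftarrow>js. a i w))"
proof -
  let ?f = "\<lambda>n m. LINT w|M n. (\<Prod>i\<leftarrow>js. scaled_eigenvalue X n m i w)"
  let ?L = "\<lambda>s. \<Prod>i\<in>{1..p}. gauss_moment s (count_list js i)"
  let ?E = "\<lambda>n. {m. limit_variance n m \<noteq> 1}"
  have lim: "(\<lambda>n. (\<Sum>m<n. ?f n m) / real n) \<longlonglongrightarrow> ?L 1"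
  proof (rule average_limit[where E = ?E])
    show "\<forall>\<^sub>F n in sequentially. \<forall>m. m \<notin> ?E n \<longrightarrow> \<bar>?f n m - ?L 1\<bar> < e" if "e > 0" for e
      using eigenvalue_word_limit[OF I js, of 1 e] that by simp
    show "\<forall>\<^sub>F n in sequentially. \<forall>m\<in>?E n. \<bar>?f n m - ?L 1\<bar> \<le> 1 + \<bar>?L 2 - ?L 1\<bar>"
      using eigenvalue_word_limit[OF I js, of 2 1, simplified]
    proof eventually_elim
      case (elim n)
      show ?case
      proof
        fix m assume "m \<in> ?E n"
        then have "limit_variance n m = 2" by (auto simp: limit_variance_def split: if_splits)
        then have "\<bar>?f n m - ?L 2\<bar> < 1" using elim by simp
        then show "\<bar>?f n m - ?L 1\<bar> \<le> 1 + \<bar>?L 2 - ?L 1\<bar>" by linarith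
      qed
    qed
    show "card {m. m < n \<and> m \<in> ?E n} \<le> 2" if "n \<ge> 1" for n
      using card_limit_variance[OF that] by simp
  qed
  have L: "?L 1 = (LINT w|N. (\<Prod>i\<leftarrow>js. a i w))"
    by (subst expectation_indep_prod_list[OF N _ a(1) std_normal_moments(1)[OF N a(2)] js])
      (simp_all add: std_normal_moments(2)[OF N a(2)])
  have eq: "(LINT w|M n. mat_trace (foldr (\<lambda>i B. sc_matrix X i n w * B) js (1\<^sub>m n))) /
      (real n * sqrt (real n) ^ length js) = (\<Sum>m<n. ?f n m) / real n" if n: "n \<ge> 1" for n
  proof -
    have scale: "(\<Prod>i\<leftarrow>js. circ_eigenvalue n (\<lambda>t. X i n t w) m) =
        sqrt (real n) ^ length js * (\<Prod>i\<leftarrow>js. scaled_eigenvalue X n m i w)" for w m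
      using n by (induction js) (auto simp: scaled_eigenvalue_def)
    have "integrable (M n) (\<lambda>w. \<Prod>i\<leftarrow>js. scaled_eigenvalue X n m i w)" for m
      using js by (intro has_moments_integrable has_moments_prod_list
          assumption_I_indep(1)[OF I n] has_moments_scaled_eigenvalue[OF I n]) auto
    then have "(LINT w|M n. mat_trace (foldr (\<lambda>i B. sc_matrix X i n w * B) js (1\<^sub>m n))) =
        sqrt (real n) ^ length js * (\<Sum>m<n. ?f n m)"
      unfolding trace_sc_product[OF n] scale
      by (subst Bochner_Integration.integral_sum) (simp_all add: sum_distrib_left)
    then show ?thesis using n by simp
  qed
  have "\<forall>\<^sub>F n in sequentially. (\<Sum>m<n. ?f n m) / real n =
      (LINT w|M n. mat_trace (foldr (\<lambda>i B. sc_matrix X i n w * B) js (1\<^sub>m n))) /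
      (real n * sqrt (real n) ^ length js)"
    by (rule eventually_mono[OF eventually_ge_at_top[of 1]]) (rule eq[symmetric])
  from Lim_transform_eventually[OF lim this] show ?thesis unfolding L .
qed

section \<open>Convergence in law\<close>

lemma (in nc_prob_space) state_zero: "state A \<zero> = 0"
  using state_add[of \<zero> \<zero>] by simp

lemma (in nc_prob_space) state_nc_poly_eval:
  assumes P: "P \<in> nc_polys p" and a: "\<And>i. i \<in> {1..p} \<Longrightarrow> a i \<in> carrier A"
  shows "state A (nc_poly_eval A a P) = (\<Sum>w\<in>{w. P w \<noteq> 0}. P w * state A (nc_monom_eval A a w))"
proof -
  have add: "abelian_monoid A" by unfold_locales
  have monom: "nc_monom_eval A a w \<in> carrier A" if "set w \<subseteq> {1..p}" for w
    using that a by (induction w) (auto simp: nc_monom_eval_def)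
  have "state A (\<Oplus>w\<in>W. P w \<odot> nc_monom_eval A a w) = (\<Sum>w\<in>W. P w * state A (nc_monom_eval A a w))"
    if "finite W" "W \<subseteq> {w. P w \<noteq> 0}" for W
    using that
  proof (induction W)
    case empty
    then show ?case by (simp add: state_zero)
  next
    case (insert w W)
    have summand: "nc_monom_eval A a v \<in> carrier A" "P v \<odot> nc_monom_eval A a v \<in> carrier A"
      if "P v \<noteq> 0" for v
      using that P monom[of v] smult_closed[of "P v"] by (auto simp: nc_polys_def)
    have sum: "(\<Oplus>w\<in>W. P w \<odot> nc_monom_eval A a w) \<in> carrier A"
      using insert.prems summand by (intro abelian_monoid.finsum_closed[OF add]) auto
    have "(\<Oplus>w\<in>insert w W. P w \<odot> nc_monom_eval A a w) =
        P w \<odot> nc_monom_eval A a w \<oplus> (\<Oplus>w\<in>W. P w \<odot> nc_monom_eval A a w)"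
      using insert summand by (intro abelian_monoid.finsum_insert[OF add]) auto
    then show ?case
      using insert summand[of w] sum by (simp add: state_add state_smult)
  qed
  then show ?thesis using P by (simp add: nc_poly_eval_def nc_polys_def)
qed

lemma nc_monom_eval_random_matrix:
  "nc_monom_eval (random_matrix_space M n)
     (\<lambda>i w. map_mat complex_of_real ((1 / sqrt (real n)) \<cdot>\<^sub>m sc_matrix X i n w)) js =
   (\<lambda>w. map_mat complex_of_real ((1 / sqrt (real n)) ^ length js \<cdot>\<^sub>m
      foldr (\<lambda>i B. sc_matrix X i n w * B) js (1\<^sub>m n)))"
proof (induction js)
  case Nil
  show ?case
    by (auto simp: nc_monom_eval_def random_matrix_space_def intro!: ext eq_matI)
next
  case (Cons i js)
  let ?c = "1 / sqrt (real n)"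
  have "map_mat complex_of_real (?c \<cdot>\<^sub>m A) * map_mat complex_of_real (?c ^ length js \<cdot>\<^sub>m B) =
      map_mat complex_of_real (?c ^ Suc (length js) \<cdot>\<^sub>m (A * B))"
    if A: "A \<in> carrier_mat n n" and B: "B \<in> carrier_mat n n" for A B
  proof -
    have "map_mat complex_of_real (?c \<cdot>\<^sub>m A) * map_mat complex_of_real (?c ^ length js \<cdot>\<^sub>m B) =
        map_mat complex_of_real ((?c \<cdot>\<^sub>m A) * (?c ^ length js \<cdot>\<^sub>m B))"
      using A B by (intro of_real_hom.mat_hom_mult[symmetric]) auto
    also have "(?c \<cdot>\<^sub>m A) * (?c ^ length js \<cdot>\<^sub>m B) = ?c ^ Suc (length js) \<cdot>\<^sub>m (A * B)"
      using carrier_matD[OF A] carrier_matD[OF B]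
      by (intro eq_matI) (simp_all add: scalar_prod_def sum_distrib_left mult_ac)
    finally show ?thesis .
  qed
  moreover have "sc_matrix X i n w \<in> carrier_mat n n" for w
    by (simp add: sc_matrix_def sym_circulant_def)
  ultimately show ?case
    using Cons carrier_sc_product[of X n _ js]
    by (simp add: nc_monom_eval_def random_matrix_space_def)
qed

lemma state_random_matrix_monom:
  "state (random_matrix_space M n) (nc_monom_eval (random_matrix_space M n)
     (\<lambda>i w. map_mat complex_of_real ((1 / sqrt (real n)) \<cdot>\<^sub>m sc_matrix X i n w)) js) =
   complex_of_real ((LINT w|M. mat_trace (foldr (\<lambda>i B. sc_matrix X i n w * B) js (1\<^sub>m n))) /
      (real n * sqrt (real n) ^ length js))"
proof -
  have trace: "mat_trace (map_mat complex_of_real (c \<cdot>\<^sub>m A)) = complex_of_real (c * mat_trace A)"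
    if "A \<in> carrier_mat n n" for c A
    using that by (simp add: mat_trace_def sum_distrib_left)
  have "state (random_matrix_space M n) f = 1 / of_nat n * (LINT w|M. mat_trace (f w))" for f
    by (simp add: random_matrix_space_def)
  then show ?thesis
    by (simp add: nc_monom_eval_random_matrix trace[OF carrier_sc_product] power_divide)
qed

lemma state_random_variable_monom:
  "state (random_variable_space N) (nc_monom_eval (random_variable_space N) (\<lambda>i w. complex_of_real (a i w)) js) =
   complex_of_real (LINT w|N. (\<Prod>i\<leftarrow>js. a i w))"
proof -
  have "nc_monom_eval (random_variable_space N) (\<lambda>i w. complex_of_real (a i w)) js =
      (\<lambda>w. complex_of_real (\<Prod>i\<leftarrow>js. a i w))"
    by (induction js) (simp_all add: nc_monom_eval_def random_variable_space_def)
  then show ?thesis by (simp add: random_variable_space_def)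
qed

lemma sc_matrix_in_random_matrix_space:
  assumes I: "assumption_I p M X" and n: "n \<ge> 1" and i: "i \<in> {1..p}"
  shows "(\<lambda>w. map_mat complex_of_real (c \<cdot>\<^sub>m sc_matrix X i n w)) \<in> carrier (random_matrix_space (M n) n)"
proof -
  have "(\<lambda>w. map_mat complex_of_real (c \<cdot>\<^sub>m sc_matrix X i n w) $$ (j, k)) \<in> finite_moments (M n)"
    if jk: "j < n" "k < n" for j k
  proof -
    define d where "d = nat \<bar>int k - int j\<bar>"
    have d: "d < n" using jk by (simp add: d_def)
    have "cyc_dist n (int k - int j) = cyc_dist n (int d)"
      by (cases "k \<ge> j") (simp_all add: d_def, metis cyc_dist_minus minus_diff_eq)
    then have "link n (Suc j) (Suc k) \<le> n div 2"
      using link_eq_cyc_dist[OF jk] cyc_dist_pos[OF d] by auto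
    then have "has_moments (M n) (\<lambda>w. c * X i n (link n (Suc j) (Suc k)) w)"
      by (rule has_moments_cmult[OF assumption_I_indep(1)[OF I n] has_moments_input[OF I n i]])
    then show ?thesis
      using jk by (simp add: sc_matrix_def sym_circulant_def)
  qed
  then show ?thesis
    by (simp add: random_matrix_space_def) (simp add: sc_matrix_def sym_circulant_def)
qed

theorem mainTheorem3:
  fixes p :: nat
    and M :: "nat \<Rightarrow> 'w measure"
    and X :: "nat \<Rightarrow> nat \<Rightarrow> nat \<Rightarrow> 'w \<Rightarrow> real"
    and N :: "'v measure"
    and a :: "nat \<Rightarrow> 'v \<Rightarrow> real"
  assumes "assumption_I p M X"
    and "prob_space N"
    and "prob_space.indep_vars N (\<lambda>_. borel) a {1..p}"
    and "\<forall>i\<in>{1..p}. distributed N lborel (a i) (\<lambda>x. ennreal (std_normal_density x))"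
  shows "converges_in_law p
           (\<lambda>n. random_matrix_space (M n) n)
           (\<lambda>n i w. map_mat complex_of_real ((1 / sqrt (real n)) \<cdot>\<^sub>m sc_matrix X i n w))
           (random_variable_space N)
           (\<lambda>i w. complex_of_real (a i w))
       \<and> (\<forall>k\<ge>1. \<forall>js. length js = k \<and> set js \<subseteq> {1..p} \<longrightarrow>
           (\<lambda>n. 1 / real n powr (1 + real k / 2) *
                (LINT w|M n. mat_trace (foldr (\<lambda>i B. sc_matrix X i n w * B) js (1\<^sub>m n))))
           \<longlonglongrightarrow> (LINT w|N. (\<Prod>i\<leftarrow>js. a i w)))"
proof (intro conjI allI impI)
  note I = assms(1) and N = assms(2)
  have normal: "\<And>i. i \<in> {1..p} \<Longrightarrow> distributed N lborel (a i) (\<lambda>x. ennreal (std_normal_density x))"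
    using assms(4) by blast
  note word = trace_word_limit[OF I N assms(3) normal]
  let ?A = "\<lambda>n. random_matrix_space (M n) n"
  let ?a = "\<lambda>n i w. map_mat complex_of_real ((1 / sqrt (real n)) \<cdot>\<^sub>m sc_matrix X i n w)"
  let ?B = "random_variable_space N" and ?b = "\<lambda>i w. complex_of_real (a i w)"
  have A: "nc_prob_space (?A n)" "\<And>i. i \<in> {1..p} \<Longrightarrow> ?a n i \<in> carrier (?A n)" if "n \<ge> 1" for n
    using nc_prob_space_random_matrix_space[OF assumption_I_indep(1)[OF I that] that]
      sc_matrix_in_random_matrix_space[OF I that] by blast+
  have B: "nc_prob_space ?B" "\<And>i. i \<in> {1..p} \<Longrightarrow> ?b i \<in> carrier ?B"
    using nc_prob_space_random_variable_space[OF N] std_normal_moments(1)[OF N normal]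
    by (auto simp: random_variable_space_def)
  have "(\<lambda>n. state (?A n) (nc_poly_eval (?A n) (?a n) P)) \<longlonglongrightarrow> state ?B (nc_poly_eval ?B ?b P)"
    if P: "P \<in> nc_polys p" for P
  proof -
    have "(\<lambda>n. \<Sum>w\<in>{w. P w \<noteq> 0}. P w * state (?A n) (nc_monom_eval (?A n) (?a n) w)) \<longlonglongrightarrow>
        (\<Sum>w\<in>{w. P w \<noteq> 0}. P w * state ?B (nc_monom_eval ?B ?b w))"
      unfolding state_random_matrix_monom state_random_variable_monom
    proof (intro tendsto_sum tendsto_mult_left tendsto_of_real word)
      fix w assume "w \<in> {w. P w \<noteq> 0}"
      then show "set w \<subseteq> {1..p}" using P by (simp add: nc_polys_def)
    qed
    moreover have "\<forall>\<^sub>F n in sequentially.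
        (\<Sum>w\<in>{w. P w \<noteq> 0}. P w * state (?A n) (nc_monom_eval (?A n) (?a n) w)) =
        state (?A n) (nc_poly_eval (?A n) (?a n) P)"
      using eventually_ge_at_top[of 1]
      by eventually_elim (rule nc_prob_space.state_nc_poly_eval[OF A(1) P A(2), symmetric])
    moreover have "state ?B (nc_poly_eval ?B ?b P) =
        (\<Sum>w\<in>{w. P w \<noteq> 0}. P w * state ?B (nc_monom_eval ?B ?b w))"
      by (rule nc_prob_space.state_nc_poly_eval[OF B(1) P B(2)])
    ultimately show ?thesis
      by (simp only: Lim_transform_eventually)
  qed
  then show "converges_in_law p ?A ?a ?B ?b"
    unfolding converges_in_law_def using A B by blast
  fix k js assume k: "k \<ge> 1" and js: "length js = k \<and> set js \<subseteq> {1..p}"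
  have "1 / real n powr (1 + real k / 2) = 1 / (real n * sqrt (real n) ^ length js)" for n
  proof (cases "n = 0")
    case False
    have "sqrt (real n) ^ k = (real n powr (1 / 2)) powr real k"
      using False by (simp add: powr_half_sqrt powr_realpow)
    then show ?thesis using False js by (simp add: powr_add powr_powr)
  qed simp
  then show "(\<lambda>n. 1 / real n powr (1 + real k / 2) *
      (LINT w|M n. mat_trace (foldr (\<lambda>i B. sc_matrix X i n w * B) js (1\<^sub>m n))))
      \<longlonglongrightarrow> (LINT w|N. (\<Prod>i\<leftarrow>js. a i w))"
    using word[OF _ conjunct2[OF js]] js by simp
qed

end
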